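(* Let $(\mathcal{S}_X,\mathcal{S}_Y,\Lambda)$ be a Langland-Poisson triple with $(\mathbf r,\mathbf z)$-cluster pattern $\mathcal{S}_X=\{(\mathbf{x}_t,\tilde B_t)\}_{t\in\mathbb{T}_n}$ and upper $(\mathbf r,\mathbf z)$-cluster algebra $\mathcal{U}$, and let $\mathcal{U}^{good}$ be its set of good elements. The pairing $\langle-\parallel-\rangle_t:\mathcal{U}^{good}\times\mathcal{U}^{good}\to\mathbb{Z}$, $$\langle u\parallel u'\rangle_t=\mathbf g_t^\top\Lambda_t\mathbf g'_t+F_t\bigl[[D\mid 0]\mathbf g'_t\bigr],$$ where $u=\mathbf x_t^{\mathbf g_t}F_t(\hat y_{1;t},\dots,\hat y_{n;t})$ and $u'=\mathbf x_t^{\mathbf g'_t}F'_t(\hat y_{1;t},\dots,\hat y_{n;t})$ with $\mathbf{g}_t=\deg^t(u)$, $\mathbf{g}'_t=\deg^t(u')$, is independent of the choice of the vertex $t\in\mathbb{T}_n$.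
   Context: Notation. $m\ge n\ge1$ are integers, $[1,n]=\{1,\dots,n\}$, $\mathbf r=(r_1,\dots,r_n)$ positive integers, $[a]_+=\max(a,0)$. $\mathbf z=(z_{i,s})_{1\le i\le n,1\le s\le r_i-1}$ are formal variables with $z_{i,s}=z_{i,r_i-s}$; $z_{i,0}=z_{i,r_i}=1$. $\mathcal F=\mathbb Q(\mathbf z,x_1,\dots,x_m)$. $\mathbb{P}$ is the multiplicative group of Laurent monomials in $x_{n+1},\dots,x_m$ and $\mathbf z$, and $\mathbb{ZP}$ its group ring. Pattern. $\mathbb T_n$ is the $n$-regular tree with edges labeled by $[1,n]$, the $n$ edges at each vertex having distinct labels; vertices joined by an edge labeled $k$ are $k$-adjacent. $\mathcal S_X$ assigns to each $t\in\mathbb T_n$ a seed: $\mathbf x_t=(x_{1;t},\dots,x_{m;t})$, an $m$-tuple in $\mathcal F$ algebraically independent over $\mathbb Q(\mathbf z)$, and an $m\times n$ integer matrix $\tilde B_t=(b_{ij;t})$ with skew-symmetrizable principal part (first $n$ rows); at a root vertex $t_0$, $\mathbf x_{t_0}=(x_1,\dots,x_m)$. For $k$-adjacent $t,t'$: $x_{i;t'}=x_{i;t}$ for $i\ne k$, $x_{k;t'}=x_{k;t}^{-1}\bigl(\prod_{j=1}^m x_{j;t}^{[-\varepsilon b_{jk;t}]_+}\bigr)^{r_k}\sum_{s=0}^{r_k}z_{k,s}\hat y_{k;t}^{\varepsilon s}$ with $\hat y_{k;t}=\prod_{j=1}^m x_{j;t}^{b_{jk;t}}$; $b_{ij;t'}=-b_{ij;t}$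 if $i=k$ or $j=k$, and $b_{ij;t'}=b_{ij;t}+r_k([-\varepsilon b_{ik;t}]_+b_{kj;t}+b_{ik;t}[\varepsilon b_{kj;t}]_+)$ otherwise (independent of $\varepsilon\in\{\pm1\}$). $\mathcal U=\bigcap_{t}\mathbb{ZP}[x_{1;t}^{\pm1},\dots,x_{m;t}^{\pm1}]\subset\mathcal F$. Langland-Poisson triple. $\Lambda=\{\Lambda_t\}$ consists of skew-symmetric integer $m\times m$ matrices with $\tilde B_t^\top\Lambda_t=[D\mid 0]$ (an $n\times m$ matrix), $D=\operatorname{diag}(d_1,\dots,d_n)$ with positive integers $d_i$ (so $\tilde B_t$ has rank $n$), and $\Lambda_{t'}=E^\top\Lambda_tE$ for $k$-adjacent $t,t'$, where $E$ differs from $I_m$ only in column $k$, with $E_{kk}=-1$ and $E_{ik}=[-\varepsilon b_{ik;t}r_k]_+$ for $i\ne k$ (independent of $\varepsilon$). $\mathcal S_Y$ is the Langlands dual $Y$-pattern, with $n\times m$ exchange matrices $\hat B_t=(\hat b_{ij;t})=-\tilde B_t^\top$. A tropical point in $\mathcal S_Y(\mathbb Z^{\max})$ is a family $\{\mathbf g_t=(g_{1;t},\dots,g_{m;t})^\top\in\mathbb Z^m\mid t\in\mathbb T_n\}$ such that for $k$-adjacent $t,t'$: $g_{k;t'}=-g_{k;t}$ and $g_{i;t'}=g_{i;t}+[r_k\hat b_{ki;t}]_+g_{k;t}-r_k\hat b_{ki;t}[g_{k;t}]_+$ for $i\ne k$. Pointed and good elements. For $\mathbf g,\mathbf g'\in\mathbb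 Z^m$ write $\mathbf g'\le_t\mathbf g$ if $\mathbf g'=\mathbf g+\tilde B_t\nu$ for some $\nu\in\mathbb N^n$. An element $u\in\mathcal U$ is pointed at $t$ if $u=\sum_{\mathbf h}b_{\mathbf h}\mathbf x_t^{\mathbf h}$ with $b_{\mathbf h}\in\mathbb Z[\mathbf z]$, the set $\{\mathbf h: b_{\mathbf h}\neq0\}$ has a unique maximal element $\mathbf g$ under $\le_t$, and $b_{\mathbf g}=1$; then $\deg^t(u):=\mathbf g$ and $u=\mathbf x_t^{\mathbf g}F_t(\hat y_{1;t},\dots,\hat y_{n;t})$ with $F_t\in\mathbb Z[\mathbf z][\hat y_{1;t},\dots,\hat y_{n;t}]$ of constant term $1$. $u$ is $[\mathbf g]$-pointed if it is pointed at every $t$ and $[\mathbf g]=\{\deg^t(u)\}_{t}$ is a tropical point in $\mathcal S_Y(\mathbb Z^{\max})$. It is $[\mathbf g]$-good if moreover for every $t$ it has a subtraction-free rational expression in $\mathbf x_t$ (and $\mathbf z$); good means $[\mathbf g]$-good for some tropical point $[\mathbf g]$. The number $F[\mathbf h]$. For a nonzero rational function $F=\bigl(\sum_{\nu\in\mathbb N^n}c_\nu\hat{\mathbf y}^\nu\bigr)/\bigl(\sum_{\mu\in\mathbb N^n}d_\mu\hat{\mathbf y}^\mu\bigr)$ with $c_\nu,d_\mu\in\mathbb Z_{\ge0}[\mathbf z]$ (finitely many nonzero), $c_0=d_0=1$, and $\mathbf h\in\mathbb Z^n$, put $F[\mathbf h]=\max\{\nu^\top\mathbf h\mid c_\nu\ne0\}-\max\{\mu^\top\mathbf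 h\mid d_\mu\neq0\}$; this is independent of the chosen expression. For a good element, $F_t$ is regarded as such a subtraction-free quotient. *)

theory Defs
  imports
    "HOL-Library.Poly_Mapping"
    "HOL-Library.Nat_Bijection"
    "HOL-Computational_Algebra.Fraction_Field"
    "Jordan_Normal_Form.Matrix"
begin

text \<open>
  Conventions.  Indices start at 0: the index set \<open>[1,n]\<close> is \<open>{..<n}\<close>, the index set
  \<open>[1,m]\<close> is \<open>{..<m}\<close>, and the frozen indices are \<open>{n..<m}\<close>.  An \<open>m\<close>-tuple of rational
  functions is a function on \<open>nat\<close> of which only the values below \<open>m\<close> are used.  Integer
  vectors and matrices are those of \<open>Jordan_Normal_Form\<close>, with explicit dimensions.
\<close>

subsection \<open>Rational functions\<close>

datatype var = XVar nat | ZVar nat nat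

text \<open>The order on variables has no meaning of its own; it is what the library needs in order
  to know that polynomials over a domain form a domain.\<close>

fun var_code :: "var \<Rightarrow> nat" where
  "var_code (XVar i) = 2 * i"
| "var_code (ZVar i s) = Suc (2 * prod_encode (i, s))"

lemma var_code_inject: "var_code v = var_code w \<Longrightarrow> v = w"
  by (cases v; cases w) (auto, presburger+)

instantiation var :: linorder
begin

definition "v \<le> w \<longleftrightarrow> var_code v \<le> var_code w"
definition "v < w \<longleftrightarrow> var_code v < var_code w"

instance
  by standard (auto simp: less_eq_var_def less_var_def intro: var_code_inject)

end

text \<open>The field of fractions of the ring of integer polynomials in all variables.\<close>

type_synonym ratfun = "((var \<Rightarrow>\<^sub>0 nat) \<Rightarrow>\<^sub>0 int) fract"

definition gen :: "var \<Rightarrow> ratfun" where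
  "gen v = Fraction_Field.Fract (Poly_Mapping.single (Poly_Mapping.single v 1) 1) 1"

definition xvar :: "nat \<Rightarrow> ratfun" where
  "xvar i = gen (XVar i)"

text \<open>Identifying \<open>s\<close> with \<open>r i - s\<close> builds in the relation \<open>z\<^sub>i\<^sub>,\<^sub>s = z\<^sub>i\<^sub>,\<^sub>r\<^sub>i\<^sub>-\<^sub>s\<close>.\<close>

definition zcoef :: "(nat \<Rightarrow> nat) \<Rightarrow> nat \<Rightarrow> nat \<Rightarrow> ratfun" where
  "zcoef r i s = (if s = 0 \<or> s = r i then 1 else gen (ZVar i (min s (r i - s))))"

definition zvars :: "nat \<Rightarrow> (nat \<Rightarrow> nat) \<Rightarrow> ratfun set" where
  "zvars n r = {zcoef r i s | i s. i < n \<and> 1 \<le> s \<and> s < r i}"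

inductive_set subfield_gen :: "'a::field set \<Rightarrow> 'a set" for S where
  "a \<in> S \<Longrightarrow> a \<in> subfield_gen S"
| "1 \<in> subfield_gen S"
| "a \<in> subfield_gen S \<Longrightarrow> b \<in> subfield_gen S \<Longrightarrow> a - b \<in> subfield_gen S"
| "a \<in> subfield_gen S \<Longrightarrow> b \<in> subfield_gen S \<Longrightarrow> a * b \<in> subfield_gen S"
| "a \<in> subfield_gen S \<Longrightarrow> inverse a \<in> subfield_gen S"

inductive_set subring_gen :: "'a::comm_ring_1 set \<Rightarrow> 'a set" for S where
  "a \<in> S \<Longrightarrow> a \<in> subring_gen S"
| "1 \<in> subring_gen S"
| "a \<in> subring_gen S \<Longrightarrow> b \<in> subring_gen S \<Longrightarrow> a - b \<in> subring_gen S"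
| "a \<in> subring_gen S \<Longrightarrow> b \<in> subring_gen S \<Longrightarrow> a * b \<in> subring_gen S"

inductive_set subsemiring_gen :: "'a::comm_semiring_1 set \<Rightarrow> 'a set" for S where
  "a \<in> S \<Longrightarrow> a \<in> subsemiring_gen S"
| "0 \<in> subsemiring_gen S"
| "1 \<in> subsemiring_gen S"
| "a \<in> subsemiring_gen S \<Longrightarrow> b \<in> subsemiring_gen S \<Longrightarrow> a + b \<in> subsemiring_gen S"
| "a \<in> subsemiring_gen S \<Longrightarrow> b \<in> subsemiring_gen S \<Longrightarrow> a * b \<in> subsemiring_gen S"

text \<open>The values of the subtraction-free rational expressions in the elements of \<open>S\<close>.\<close>

inductive_set subtraction_free :: "'a::field set \<Rightarrow> 'a set" for S where
  "a \<in> S \<Longrightarrow> a \<in> subtraction_free S"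
| "1 \<in> subtraction_free S"
| "a \<in> subtraction_free S \<Longrightarrow> b \<in> subtraction_free S \<Longrightarrow> a + b \<in> subtraction_free S"
| "a \<in> subtraction_free S \<Longrightarrow> b \<in> subtraction_free S \<Longrightarrow> a * b \<in> subtraction_free S"
| "a \<in> subtraction_free S \<Longrightarrow> b \<in> subtraction_free S \<Longrightarrow> a / b \<in> subtraction_free S"

text \<open>\<open>\<int>[z]\<close>, \<open>\<int>\<^sub>\<ge>\<^sub>0[z]\<close>, \<open>\<rat>(z)\<close> and \<open>\<rat>(z, x)\<close> as subsets of the type \<open>ratfun\<close>, which contains
  further variables.\<close>

definition Zz :: "nat \<Rightarrow> (nat \<Rightarrow> nat) \<Rightarrow> ratfun set" where
  "Zz n r = subring_gen (zvars n r)"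

definition Nz :: "nat \<Rightarrow> (nat \<Rightarrow> nat) \<Rightarrow> ratfun set" where
  "Nz n r = subsemiring_gen (zvars n r)"

definition Qz :: "nat \<Rightarrow> (nat \<Rightarrow> nat) \<Rightarrow> ratfun set" where
  "Qz n r = subfield_gen (zvars n r)"

definition ambient_field :: "nat \<Rightarrow> nat \<Rightarrow> (nat \<Rightarrow> nat) \<Rightarrow> ratfun set" where
  "ambient_field m n r = subfield_gen (zvars n r \<union> xvar ` {..<m})"

subsection \<open>Formal polynomials with coefficients in the field of rational functions\<close>

type_synonym fpoly = "(nat \<Rightarrow>\<^sub>0 nat) \<Rightarrow>\<^sub>0 ratfun"

definition fpoly_over :: "nat \<Rightarrow> ratfun set \<Rightarrow> fpoly set" where
  "fpoly_over N K =
     {P. \<forall>e \<in> Poly_Mapping.keys P. Poly_Mapping.keys e \<subseteq> {..<N} \<and> Poly_Mapping.lookup P e \<in> K}"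

definition fpoly_eval :: "nat \<Rightarrow> (nat \<Rightarrow> ratfun) \<Rightarrow> fpoly \<Rightarrow> ratfun" where
  "fpoly_eval N x P =
     (\<Sum>e \<in> Poly_Mapping.keys P.
        Poly_Mapping.lookup P e * (\<Prod>i<N. x i ^ Poly_Mapping.lookup e i))"

definition alg_independent :: "ratfun set \<Rightarrow> nat \<Rightarrow> (nat \<Rightarrow> ratfun) \<Rightarrow> bool" where
  "alg_independent K N x \<longleftrightarrow> (\<forall>P \<in> fpoly_over N K. fpoly_eval N x P = 0 \<longrightarrow> P = 0)"

subsection \<open>The labelled regular tree\<close>

text \<open>\<open>edge k t t'\<close> says that \<open>t\<close> and \<open>t'\<close> are \<open>k\<close>-adjacent.  The last condition excludes cycles
  (of length at least 3, as there are neither loops nor multiple edges).\<close>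

definition labelled_regular_tree :: "nat \<Rightarrow> 'v set \<Rightarrow> (nat \<Rightarrow> 'v \<Rightarrow> 'v \<Rightarrow> bool) \<Rightarrow> bool" where
  "labelled_regular_tree n V edge \<longleftrightarrow>
     V \<noteq> {} \<and>
     (\<forall>k t t'. edge k t t' \<longrightarrow> k < n \<and> t \<in> V \<and> t' \<in> V \<and> t \<noteq> t' \<and> edge k t' t) \<and>
     (\<forall>k l t t'. edge k t t' \<longrightarrow> edge l t t' \<longrightarrow> k = l) \<and>
     (\<forall>t \<in> V. \<forall>k < n. \<exists>!t'. edge k t t') \<and>
     (\<forall>t \<in> V. \<forall>t' \<in> V. (\<lambda>v w. \<exists>k. edge k v w)\<^sup>*\<^sup>* t t') \<and>
     \<not> (\<exists>p. length p \<ge> 3 \<and> distinct p \<and> successively (\<lambda>v w. \<exists>k. edge k v w) p \<and>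
            (\<exists>k. edge k (last p) (hd p)))"

subsection \<open>Cluster patterns\<close>

definition posp :: "int \<Rightarrow> int" where
  "posp a = max a 0"

definition laurent_monomial :: "nat \<Rightarrow> (nat \<Rightarrow> ratfun) \<Rightarrow> int vec \<Rightarrow> ratfun" where
  "laurent_monomial m x h = (\<Prod>i<m. x i powi (h $ i))"

definition yhat :: "nat \<Rightarrow> (nat \<Rightarrow> ratfun) \<Rightarrow> int mat \<Rightarrow> nat \<Rightarrow> ratfun" where
  "yhat m x B k = laurent_monomial m x (col B k)"

definition skew_symmetrizable :: "nat \<Rightarrow> int mat \<Rightarrow> bool" where
  "skew_symmetrizable n B \<longleftrightarrow>
     (\<exists>s :: nat \<Rightarrow> int. (\<forall>i<n. s i > 0) \<and>
        (\<forall>i<n. \<forall>j<n. s i * B $$ (i, j) = - (s j * B $$ (j, i))))"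

definition is_seed :: "nat \<Rightarrow> nat \<Rightarrow> (nat \<Rightarrow> nat) \<Rightarrow> (nat \<Rightarrow> ratfun) \<Rightarrow> int mat \<Rightarrow> bool" where
  "is_seed m n r x B \<longleftrightarrow>
     (\<forall>i<m. x i \<in> ambient_field m n r) \<and> alg_independent (Qz n r) m x \<and>
     B \<in> carrier_mat m n \<and> skew_symmetrizable n B"

text \<open>The right-hand sides of the mutation rules are written with a sign \<open>\<epsilon>\<close>; their values do not
  depend on it.\<close>

definition mutate_var ::
  "int \<Rightarrow> nat \<Rightarrow> (nat \<Rightarrow> nat) \<Rightarrow> nat \<Rightarrow> (nat \<Rightarrow> ratfun) \<Rightarrow> int mat \<Rightarrow> ratfun" where
  "mutate_var \<epsilon> m r k x B =
     inverse (x k) * (\<Prod>j<m. x j powi posp (- \<epsilon> * B $$ (j, k))) ^ r k *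
     (\<Sum>s = 0..r k. zcoef r k s * yhat m x B k powi (\<epsilon> * int s))"

definition mutate_mat :: "int \<Rightarrow> (nat \<Rightarrow> nat) \<Rightarrow> nat \<Rightarrow> int mat \<Rightarrow> int mat" where
  "mutate_mat \<epsilon> r k B = mat (dim_row B) (dim_col B)
     (\<lambda>(i, j). if i = k \<or> j = k then - B $$ (i, j)
               else B $$ (i, j) + int (r k) *
                 (posp (- \<epsilon> * B $$ (i, k)) * B $$ (k, j) + B $$ (i, k) * posp (\<epsilon> * B $$ (k, j))))"

record 'v cluster_pattern =
  nvar :: nat                               \<comment> \<open>\<open>m\<close>\<close>
  nmut :: nat                               \<comment> \<open>\<open>n\<close>\<close>
  rdeg :: "nat \<Rightarrow> nat"                     \<comment> \<open>\<open>r\<close>\<close>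
  verts :: "'v set"
  edge :: "nat \<Rightarrow> 'v \<Rightarrow> 'v \<Rightarrow> bool"
  root :: 'v
  cvar :: "'v \<Rightarrow> nat \<Rightarrow> ratfun"            \<comment> \<open>\<open>x\<^sub>i\<^sub>;\<^sub>t\<close> is \<open>cvar S t i\<close>\<close>
  exmat :: "'v \<Rightarrow> int mat"

definition rz_cluster_pattern :: "int \<Rightarrow> 'v cluster_pattern \<Rightarrow> bool" where
  "rz_cluster_pattern \<epsilon> S \<longleftrightarrow>
     1 \<le> nmut S \<and> nmut S \<le> nvar S \<and> (\<forall>i < nmut S. 1 \<le> rdeg S i) \<and>
     labelled_regular_tree (nmut S) (verts S) (edge S) \<and> root S \<in> verts S \<and>
     (\<forall>t \<in> verts S. is_seed (nvar S) (nmut S) (rdeg S) (cvar S t) (exmat S t)) \<and>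
     (\<forall>i < nvar S. cvar S (root S) i = xvar i) \<and>
     (\<forall>k t t'. edge S k t t' \<longrightarrow>
        (\<forall>i < nvar S. i \<noteq> k \<longrightarrow> cvar S t' i = cvar S t i) \<and>
        cvar S t' k = mutate_var \<epsilon> (nvar S) (rdeg S) k (cvar S t) (exmat S t) \<and>
        exmat S t' = mutate_mat \<epsilon> (rdeg S) k (exmat S t))"

definition coeff_group :: "'v cluster_pattern \<Rightarrow> ratfun set" where
  "coeff_group S =
     {(\<Prod>j \<in> {nmut S..<nvar S}. xvar j powi a j) *
      (\<Prod>i < nmut S. \<Prod>s \<in> {1..<rdeg S i}. zcoef (rdeg S) i s powi c i s)
      | (a :: nat \<Rightarrow> int) (c :: nat \<Rightarrow> nat \<Rightarrow> int). True}"

text \<open>Distinct Laurent monomials are linearly independent, so the group ring of \<open>coeff_group S\<close>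
  is the subring that this group generates.\<close>

definition ZP :: "'v cluster_pattern \<Rightarrow> ratfun set" where
  "ZP S = subring_gen (coeff_group S)"

definition upper_algebra :: "'v cluster_pattern \<Rightarrow> ratfun set" where
  "upper_algebra S =
     {u \<in> ambient_field (nvar S) (nmut S) (rdeg S). \<forall>t \<in> verts S.
        u \<in> subring_gen (ZP S \<union> cvar S t ` {..<nvar S} \<union> inverse ` cvar S t ` {..<nvar S})}"

subsection \<open>Langland-Poisson triples and tropical points\<close>

definition diag_zero :: "nat \<Rightarrow> nat \<Rightarrow> (nat \<Rightarrow> int) \<Rightarrow> int mat" where
  "diag_zero n m d = mat n m (\<lambda>(i, j). if i = j then d i else 0)"

definition mutation_E :: "int \<Rightarrow> nat \<Rightarrow> (nat \<Rightarrow> nat) \<Rightarrow> nat \<Rightarrow> int mat \<Rightarrow> int mat" where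
  "mutation_E \<epsilon> m r k B = mat m m
     (\<lambda>(i, j). if j = k then (if i = k then -1 else posp (- \<epsilon> * B $$ (i, k) * int (r k)))
               else if i = j then 1 else 0)"

definition poisson_compatible ::
  "int \<Rightarrow> 'v cluster_pattern \<Rightarrow> ('v \<Rightarrow> int mat) \<Rightarrow> (nat \<Rightarrow> int) \<Rightarrow> bool" where
  "poisson_compatible \<epsilon> S \<Lambda> d \<longleftrightarrow>
     (\<forall>i < nmut S. d i > 0) \<and>
     (\<forall>t \<in> verts S. \<Lambda> t \<in> carrier_mat (nvar S) (nvar S) \<and> transpose_mat (\<Lambda> t) = - \<Lambda> t \<and>
        transpose_mat (exmat S t) * \<Lambda> t = diag_zero (nmut S) (nvar S) d) \<and>
     (\<forall>k t t'. edge S k t t' \<longrightarrow>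
        (let E = mutation_E \<epsilon> (nvar S) (rdeg S) k (exmat S t)
         in \<Lambda> t' = transpose_mat E * \<Lambda> t * E))"

text \<open>The dual \<open>Y\<close>-pattern enters only through its tropical points, and these are determined by its
  exchange matrices; it is represented by the family of these matrices.\<close>

definition langlands_dual :: "'v cluster_pattern \<Rightarrow> ('v \<Rightarrow> int mat) \<Rightarrow> bool" where
  "langlands_dual S Y \<longleftrightarrow> (\<forall>t \<in> verts S. Y t = - transpose_mat (exmat S t))"

definition langland_poisson_triple ::
  "int \<Rightarrow> 'v cluster_pattern \<Rightarrow> ('v \<Rightarrow> int mat) \<Rightarrow> ('v \<Rightarrow> int mat) \<Rightarrow> (nat \<Rightarrow> int) \<Rightarrow> bool" where
  "langland_poisson_triple \<epsilon> S Y \<Lambda> d \<longleftrightarrow>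
     rz_cluster_pattern \<epsilon> S \<and> langlands_dual S Y \<and> poisson_compatible \<epsilon> S \<Lambda> d"

definition tropical_point ::
  "'v cluster_pattern \<Rightarrow> ('v \<Rightarrow> int mat) \<Rightarrow> ('v \<Rightarrow> int vec) \<Rightarrow> bool" where
  "tropical_point S Y g \<longleftrightarrow>
     (\<forall>t \<in> verts S. g t \<in> carrier_vec (nvar S)) \<and>
     (\<forall>k t t'. edge S k t t' \<longrightarrow>
        g t' $ k = - g t $ k \<and>
        (\<forall>i < nvar S. i \<noteq> k \<longrightarrow>
           g t' $ i = g t $ i + posp (int (rdeg S k) * Y t $$ (k, i)) * g t $ k
                      - int (rdeg S k) * Y t $$ (k, i) * posp (g t $ k)))"

subsection \<open>Pointed and good elements\<close>

definition dominance_le :: "int mat \<Rightarrow> int vec \<Rightarrow> int vec \<Rightarrow> bool" where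
  "dominance_le B g' g \<longleftrightarrow>
     (\<exists>\<nu> :: nat vec. \<nu> \<in> carrier_vec (dim_col B) \<and> g' = g + B *\<^sub>v map_vec int \<nu>)"

definition pointed_with :: "'v cluster_pattern \<Rightarrow> 'v \<Rightarrow> ratfun \<Rightarrow> int vec \<Rightarrow> bool" where
  "pointed_with S t u g \<longleftrightarrow>
     u \<in> upper_algebra S \<and>
     (\<exists>b :: int vec \<Rightarrow> ratfun.
        finite {h. b h \<noteq> 0} \<and> {h. b h \<noteq> 0} \<subseteq> carrier_vec (nvar S) \<and>
        range b \<subseteq> Zz (nmut S) (rdeg S) \<and>
        u = (\<Sum>h | b h \<noteq> 0. b h * laurent_monomial (nvar S) (cvar S t) h) \<and>
        {h. b h \<noteq> 0 \<and> (\<forall>h'. b h' \<noteq> 0 \<and> dominance_le (exmat S t) h h' \<longrightarrow> h' = h)} = {g} \<and>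
        b g = 1)"

definition pointed_at :: "'v cluster_pattern \<Rightarrow> 'v \<Rightarrow> ratfun \<Rightarrow> bool" where
  "pointed_at S t u \<longleftrightarrow> (\<exists>g. pointed_with S t u g)"

definition deg :: "'v cluster_pattern \<Rightarrow> 'v \<Rightarrow> ratfun \<Rightarrow> int vec" where
  "deg S t u = (THE g. pointed_with S t u g)"

definition F_poly :: "'v cluster_pattern \<Rightarrow> 'v \<Rightarrow> ratfun \<Rightarrow> fpoly" where
  "F_poly S t u = (THE F. F \<in> fpoly_over (nmut S) (Zz (nmut S) (rdeg S)) \<and>
     Poly_Mapping.lookup F 0 = 1 \<and>
     u = laurent_monomial (nvar S) (cvar S t) (deg S t u) *
         fpoly_eval (nmut S) (yhat (nvar S) (cvar S t) (exmat S t)) F)"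

definition g_pointed ::
  "'v cluster_pattern \<Rightarrow> ('v \<Rightarrow> int mat) \<Rightarrow> ('v \<Rightarrow> int vec) \<Rightarrow> ratfun \<Rightarrow> bool" where
  "g_pointed S Y g u \<longleftrightarrow>
     (\<forall>t \<in> verts S. pointed_at S t u \<and> deg S t u = g t) \<and> tropical_point S Y g"

definition g_good ::
  "'v cluster_pattern \<Rightarrow> ('v \<Rightarrow> int mat) \<Rightarrow> ('v \<Rightarrow> int vec) \<Rightarrow> ratfun \<Rightarrow> bool" where
  "g_good S Y g u \<longleftrightarrow> g_pointed S Y g u \<and>
     (\<forall>t \<in> verts S. u \<in> subtraction_free (cvar S t ` {..<nvar S} \<union> zvars (nmut S) (rdeg S)))"

definition good_elements :: "'v cluster_pattern \<Rightarrow> ('v \<Rightarrow> int mat) \<Rightarrow> ratfun set" where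
  "good_elements S Y = {u. \<exists>g. g_good S Y g u}"

subsection \<open>The number \<open>F[h]\<close> and the pairing\<close>

definition exp_weight :: "nat \<Rightarrow> int vec \<Rightarrow> (nat \<Rightarrow>\<^sub>0 nat) \<Rightarrow> int" where
  "exp_weight n h \<nu> = (\<Sum>i<n. int (Poly_Mapping.lookup \<nu> i) * h $ i)"

definition max_weight :: "nat \<Rightarrow> int vec \<Rightarrow> fpoly \<Rightarrow> int" where
  "max_weight n h P = Max (exp_weight n h ` Poly_Mapping.keys P)"

text \<open>Any expression as a quotient of nonzero polynomials over \<open>\<int>\<^sub>\<ge>\<^sub>0[z]\<close> is allowed, also when the
  constant terms are not 1.  By \<open>F_bracket_Fract\<close> below all of them give the same number, so this
  is the value computed from an expression with constant terms 1 whenever there is one.\<close>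

definition F_bracket :: "nat \<Rightarrow> (nat \<Rightarrow> nat) \<Rightarrow> fpoly fract \<Rightarrow> int vec \<Rightarrow> int" where
  "F_bracket n r F h = (THE c. \<exists>P Q. P \<in> fpoly_over n (Nz n r) \<and> Q \<in> fpoly_over n (Nz n r) \<and>
     P \<noteq> 0 \<and> Q \<noteq> 0 \<and> F = Fraction_Field.Fract P Q \<and> c = max_weight n h P - max_weight n h Q)"

definition pairing ::
  "'v cluster_pattern \<Rightarrow> ('v \<Rightarrow> int mat) \<Rightarrow> (nat \<Rightarrow> int) \<Rightarrow> 'v \<Rightarrow> ratfun \<Rightarrow> ratfun \<Rightarrow> int" where
  "pairing S \<Lambda> d t u u' =
     deg S t u \<bullet> (\<Lambda> t *\<^sub>v deg S t u') +
     F_bracket (nmut S) (rdeg S) (Fraction_Field.Fract (F_poly S t u) 1)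
       (diag_zero (nmut S) (nvar S) d *\<^sub>v deg S t u')"

lemma exp_weight_add: "exp_weight n h (\<nu> + \<mu>) = exp_weight n h \<nu> + exp_weight n h \<mu>"
  by (simp add: exp_weight_def lookup_add sum.distrib algebra_simps)

lemma max_weight_mult:
  assumes "P \<noteq> 0" "Q \<noteq> 0"
  shows "max_weight n h (P * Q) = max_weight n h P + max_weight n h Q"
proof -
  let ?w = "exp_weight n h" and ?W = "max_weight n h"
  have le: "?w e \<le> ?W R" if "e \<in> Poly_Mapping.keys R" for e and R :: fpoly
    using that by (simp add: max_weight_def)
  have split: "\<exists>T R'. R = T + R' \<and> T \<noteq> 0 \<and> (\<forall>e \<in> Poly_Mapping.keys T. ?w e = ?W R) \<and>
      (\<forall>e \<in> Poly_Mapping.keys R'. ?w e < ?W R)" if "R \<noteq> 0" for R :: fpoly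
  proof -
    define T where "T = Abs_poly_mapping (\<lambda>e. Poly_Mapping.lookup R e when ?w e = ?W R)"
    define R' where "R' = Abs_poly_mapping (\<lambda>e. Poly_Mapping.lookup R e when ?w e \<noteq> ?W R)"
    have T: "Poly_Mapping.lookup T e = (Poly_Mapping.lookup R e when ?w e = ?W R)" for e
      unfolding T_def
      by (subst lookup_Abs_poly_mapping)
         (auto simp: when_def intro: finite_subset[OF _ finite_lookup[of R]])
    have R': "Poly_Mapping.lookup R' e = (Poly_Mapping.lookup R e when ?w e \<noteq> ?W R)" for e
      unfolding R'_def
      by (subst lookup_Abs_poly_mapping)
         (auto simp: when_def intro: finite_subset[OF _ finite_lookup[of R]])
    have "R = T + R'"
      by (rule poly_mapping_eqI) (simp add: lookup_add T R' when_def)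
    moreover have "?W R \<in> ?w ` Poly_Mapping.keys R"
      unfolding max_weight_def by (rule Max_in) (use that in auto)
    then obtain e where "e \<in> Poly_Mapping.keys R" "?w e = ?W R" by auto
    then have "Poly_Mapping.lookup T e \<noteq> 0" by (simp add: T in_keys_iff)
    then have "T \<noteq> 0" by auto
    moreover have "\<forall>e \<in> Poly_Mapping.keys T. ?w e = ?W R"
      by (auto simp: in_keys_iff T when_def split: if_splits)
    moreover have "\<forall>e \<in> Poly_Mapping.keys R'. ?w e < ?W R"
    proof
      fix e assume "e \<in> Poly_Mapping.keys R'"
      then have "e \<in> Poly_Mapping.keys R" "?w e \<noteq> ?W R"
        by (auto simp: in_keys_iff R' when_def split: if_splits)
      then show "?w e < ?W R" using le[of e R] by simp
    qed
    ultimately show ?thesis by blast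
  qed
  obtain T R where P: "P = T + R" "T \<noteq> 0" "\<forall>e \<in> Poly_Mapping.keys T. ?w e = ?W P"
    "\<forall>e \<in> Poly_Mapping.keys R. ?w e < ?W P" using split[OF assms(1)] by blast
  obtain U V where Q: "Q = U + V" "U \<noteq> 0" "\<forall>e \<in> Poly_Mapping.keys U. ?w e = ?W Q"
    "\<forall>e \<in> Poly_Mapping.keys V. ?w e < ?W Q" using split[OF assms(2)] by blast
  have "T * U \<noteq> 0" using P(2) Q(2) by simp
  then obtain e where e: "e \<in> Poly_Mapping.keys (T * U)" by (auto simp flip: keys_eq_empty)
  have we: "?w e = ?W P + ?W Q"
    using e keys_mult[of T U] P(3) Q(3) by (fastforce simp: exp_weight_add)
  have n1: "e \<notin> Poly_Mapping.keys (T * V)"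
    using we keys_mult[of T V] P(3) Q(4) by (fastforce simp: exp_weight_add)
  have n2: "e \<notin> Poly_Mapping.keys (R * Q)"
  proof
    assume "e \<in> Poly_Mapping.keys (R * Q)"
    then obtain a b where "a \<in> Poly_Mapping.keys R" "b \<in> Poly_Mapping.keys Q" "e = a + b"
      using keys_mult[of R Q] by auto
    then show False using we P(4) le[of b Q] by (fastforce simp: exp_weight_add)
  qed
  have "P * Q = T * U + (T * V + R * Q)" by (simp add: P(1) Q(1) algebra_simps)
  then have "Poly_Mapping.lookup (P * Q) e = Poly_Mapping.lookup (T * U) e"
    using n1 n2 by (simp add: lookup_add in_keys_iff)
  then have eP: "e \<in> Poly_Mapping.keys (P * Q)" using e by (simp add: in_keys_iff)
  show ?thesis
    unfolding max_weight_def[of n h "P * Q"]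
  proof (rule Max_eqI)
    show "?W P + ?W Q \<in> ?w ` Poly_Mapping.keys (P * Q)" using eP we by force
    fix c assume "c \<in> ?w ` Poly_Mapping.keys (P * Q)"
    then obtain a b where "a \<in> Poly_Mapping.keys P" "b \<in> Poly_Mapping.keys Q" "c = ?w (a + b)"
      using keys_mult[of P Q] by auto
    then show "c \<le> ?W P + ?W Q" using le[of a P] le[of b Q] by (simp add: exp_weight_add)
  qed simp
qed

lemma F_bracket_Fract:
  assumes "P \<in> fpoly_over n (Nz n r)" "Q \<in> fpoly_over n (Nz n r)" "P \<noteq> 0" "Q \<noteq> 0"
  shows "F_bracket n r (Fraction_Field.Fract P Q) h = max_weight n h P - max_weight n h Q"
  unfolding F_bracket_def
proof (rule the_equality)
  fix c assume "\<exists>P' Q'. P' \<in> fpoly_over n (Nz n r) \<and> Q' \<in> fpoly_over n (Nz n r) \<and>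
    P' \<noteq> 0 \<and> Q' \<noteq> 0 \<and> Fraction_Field.Fract P Q = Fraction_Field.Fract P' Q' \<and> c = max_weight n h P' - max_weight n h Q'"
  then obtain P' Q' where *: "P' \<noteq> 0" "Q' \<noteq> 0" "Fraction_Field.Fract P Q = Fraction_Field.Fract P' Q'"
    "c = max_weight n h P' - max_weight n h Q'" by blast
  then have "P * Q' = P' * Q" using assms by (simp add: Fraction_Field.eq_fract)
  then have "max_weight n h P + max_weight n h Q' = max_weight n h P' + max_weight n h Q"
    using max_weight_mult[of P Q' n h] max_weight_mult[of P' Q n h] * assms by simp
  then show "c = max_weight n h P - max_weight n h Q" using *(4) by simp
qed (use assms in blast)

end

theory Submission
  imports Defs
begin

text \<open>
  Fix the tropical point \<open>g'\<close> of \<open>u'\<close> and put \<open>w\<^sub>t = \<Lambda>\<^sub>t g'\<^sub>t\<close>.  Tropicalizing at \<open>x\<^sub>i\<^sub>;\<^sub>t = w\<^sub>t\<^sub>,\<^sub>i\<close>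
  assigns an integer to every subtraction-free expression in \<open>x\<^sub>t\<close> and \<open>z\<close>.  By the compatibility
  \<open>B\<^sub>t\<^sup>T \<Lambda>\<^sub>t = [D | 0]\<close> the variable \<open>y\<^sub>k\<^sub>;\<^sub>t\<close> gets the value \<open>d\<^sub>k g'\<^sub>k\<^sub>;\<^sub>t\<close>, so the value of \<open>u = x\<^sub>t\<^sup>g F\<^sub>t(y)\<close> is the
  pairing at \<open>t\<close>; here a grading argument turns a subtraction-free expression of \<open>u\<close> in \<open>x\<^sub>t\<close> into one
  of \<open>F\<^sub>t\<close> in \<open>y\<close>.  The mutation rules of \<open>\<Lambda>\<close> and \<open>g'\<close> combine to the tropicalized exchange relation
  for \<open>w\<close>, so the values computed at adjacent vertices agree.
\<close>

text \<open>Tropicalization acts on expressions, but the proof needs a value of the element itself.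
  Two facts provide it: coefficients in \<open>Nz\<close> cannot cancel, so adding polynomials takes
  the maximum of their weights, and algebraic independence of a cluster turns equality of elements
  into equality of formal polynomials. As an element then has at most one value in a given cluster,
  no F-polynomial has to be mutated: one expression of \<open>u\<close> is valued in two clusters,
  and only the generators have to be compared. The obstacle is that \<open>F_bracket\<close> asks
  for a quotient of polynomials in y with coefficients in \<open>Nz\<close>, while goodness supplies
  one in x, whose terms may leave the lattice of y-monomials. Positivity survives the passage from x
  to y because terms are selected, never subtracted. Besides computing the weights of y,
  compatibility with positive \<open>d k\<close> makes the exchange matrix injective, so that y is
  algebraically independent as well.\<close>

definition subsemiring :: "'a::comm_semiring_1 set \<Rightarrow> bool" where
  "subsemiring K \<longleftrightarrow> 0 \<in> K \<and> 1 \<in> K \<and> (\<forall>a\<in>K. \<forall>b\<in>K. a + b \<in> K \<and> a * b \<in> K)"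

lemma subsemiring_0: "subsemiring K \<Longrightarrow> 0 \<in> K"
  and subsemiring_1: "subsemiring K \<Longrightarrow> 1 \<in> K"
  and subsemiring_add: "subsemiring K \<Longrightarrow> a \<in> K \<Longrightarrow> b \<in> K \<Longrightarrow> a + b \<in> K"
  and subsemiring_mult: "subsemiring K \<Longrightarrow> a \<in> K \<Longrightarrow> b \<in> K \<Longrightarrow> a * b \<in> K"
  by (auto simp: subsemiring_def)

lemma subring_gen_0: "(0::'a::comm_ring_1) \<in> subring_gen A"
  using subring_gen.intros(3)[OF subring_gen.intros(2) subring_gen.intros(2), of A] by simp

lemma subring_gen_add: "a \<in> subring_gen A \<Longrightarrow> b \<in> subring_gen A \<Longrightarrow> a + b \<in> subring_gen A"
  using subring_gen.intros(3)[OF _ subring_gen.intros(3)[OF subring_gen_0, of b A], of a] by simp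

lemma subfield_gen_0: "(0::'a::field) \<in> subfield_gen A"
  using subfield_gen.intros(3)[OF subfield_gen.intros(2) subfield_gen.intros(2), of A] by simp

lemma subfield_gen_add: "a \<in> subfield_gen A \<Longrightarrow> b \<in> subfield_gen A \<Longrightarrow> a + b \<in> subfield_gen A"
  using subfield_gen.intros(3)[OF _ subfield_gen.intros(3)[OF subfield_gen_0, of b A], of a] by simp

text \<open>Three coefficient domains occur: \<open>Zz\<close> for F-polynomials, \<open>Nz\<close>
  for tropical values and \<open>Qz\<close> for algebraic independence. Treating them as
  subsemirings lets the closure lemmas for \<open>fpoly_over\<close> be proved once for all
  three.\<close>

lemma subsemiring_Zz: "subsemiring (Zz n r)"
  unfolding subsemiring_def Zz_def
  by (intro conjI ballI subring_gen_0 subring_gen_add subring_gen.intros(2,4))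

lemma subsemiring_Nz: "subsemiring (Nz n r)"
  unfolding subsemiring_def Nz_def
  by (auto intro: subsemiring_gen.intros)

lemma subsemiring_Qz: "subsemiring (Qz n r)"
  unfolding subsemiring_def Qz_def
  by (intro conjI ballI subfield_gen_0 subfield_gen_add subfield_gen.intros(2,4))

lemma Zz_subset_Qz: "Zz n r \<subseteq> Qz n r"
proof
  fix a assume "a \<in> Zz n r"
  then show "a \<in> Qz n r"
    unfolding Zz_def Qz_def by induction (auto intro: subfield_gen.intros)
qed

lemma Nz_subset_Qz: "Nz n r \<subseteq> Qz n r"
proof
  fix a assume "a \<in> Nz n r"
  then show "a \<in> Qz n r"
    unfolding Nz_def Qz_def
    by induction (auto intro: subfield_gen.intros subfield_gen_0 subfield_gen_add)
qed

lemma Qz_minus: "a \<in> Qz n r \<Longrightarrow> - a \<in> Qz n r"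
  using subfield_gen.intros(3)[OF subfield_gen_0, of a] by (simp add: Qz_def)

section \<open>Positivity of the coefficient semiring\<close>

definition nonneg_poly :: "('a::monoid_add \<Rightarrow>\<^sub>0 int) \<Rightarrow> bool" where
  "nonneg_poly p \<longleftrightarrow> (\<forall>e. Poly_Mapping.lookup p e \<ge> 0)"

lemma poly_mapping_sum_single:
  "P = (\<Sum>e\<in>Poly_Mapping.keys P. Poly_Mapping.single e (Poly_Mapping.lookup P e))"
proof (rule poly_mapping_eqI)
  fix k
  show "Poly_Mapping.lookup P k =
    Poly_Mapping.lookup (\<Sum>e\<in>Poly_Mapping.keys P. Poly_Mapping.single e (Poly_Mapping.lookup P e)) k"
    by (simp add: lookup_sum lookup_single when_def in_keys_iff)
qed

lemma poly_mapping_mult_sum: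
  fixes P Q :: "'a::monoid_add \<Rightarrow>\<^sub>0 'b::semiring_0"
  shows "P * Q = (\<Sum>a\<in>Poly_Mapping.keys P. \<Sum>b\<in>Poly_Mapping.keys Q.
      Poly_Mapping.single (a + b) (Poly_Mapping.lookup P a * Poly_Mapping.lookup Q b))"
proof -
  have "P * Q = (\<Sum>a\<in>Poly_Mapping.keys P. Poly_Mapping.single a (Poly_Mapping.lookup P a)) *
     (\<Sum>b\<in>Poly_Mapping.keys Q. Poly_Mapping.single b (Poly_Mapping.lookup Q b))"
    by (simp only: poly_mapping_sum_single[symmetric])
  also have "\<dots> = (\<Sum>a\<in>Poly_Mapping.keys P. \<Sum>b\<in>Poly_Mapping.keys Q.
      Poly_Mapping.single (a + b) (Poly_Mapping.lookup P a * Poly_Mapping.lookup Q b))"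
    by (simp only: sum_product mult_single)
  finally show ?thesis .
qed

lemma nonneg_poly_mult:
  assumes "nonneg_poly p" "nonneg_poly q"
  shows "nonneg_poly (p * q)"
  using assms unfolding nonneg_poly_def poly_mapping_mult_sum[of p q]
  by (simp add: lookup_sum lookup_single when_def sum_nonneg)

text \<open>Membership in \<open>Nz\<close> is a closure property in which no sign is visible; an
  integer polynomial as representative makes positivity checkable coefficient by
  coefficient.\<close>

lemma Nz_nonneg:
  assumes "a \<in> Nz n r"
  shows "\<exists>p. nonneg_poly p \<and> a = Fraction_Field.Fract p 1"
  using assms unfolding Nz_def
proof induction
  case (1 a)
  then obtain i s where "a = zcoef r i s"
    unfolding zvars_def by blast
  then obtain v where "a = 1 \<or> a = gen v"
    unfolding zcoef_def by metis
  moreover have "nonneg_poly 1" and "nonneg_poly (Poly_Mapping.single b 1)" for b :: "var \<Rightarrow>\<^sub>0 nat"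
    by (auto simp: nonneg_poly_def lookup_one lookup_single when_def)
  ultimately show ?case
    by (auto simp: gen_def Fraction_Field.One_fract_def)
next
  case 2
  then show ?case
    by (intro exI[of _ 0]) (auto simp: nonneg_poly_def Fraction_Field.Zero_fract_def)
next
  case 3
  then show ?case
    by (intro exI[of _ 1]) (auto simp: nonneg_poly_def lookup_one when_def Fraction_Field.One_fract_def)
next
  case (4 a b)
  then obtain p q where "nonneg_poly p" "a = Fraction_Field.Fract p 1"
    "nonneg_poly q" "b = Fraction_Field.Fract q 1" by blast
  then show ?case
    by (intro exI[of _ "p + q"]) (auto simp: nonneg_poly_def lookup_add)
next
  case (5 a b)
  then obtain p q where "nonneg_poly p" "a = Fraction_Field.Fract p 1"
    "nonneg_poly q" "b = Fraction_Field.Fract q 1" by blast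
  then show ?case
    by (intro exI[of _ "p * q"]) (auto simp: nonneg_poly_mult)
qed

text \<open>No cancellation: nonnegative coefficients can only add up to zero if each of them is
  zero.\<close>

lemma Nz_add_eq_0:
  assumes "a \<in> Nz n r" "b \<in> Nz n r" "a + b = 0"
  shows "a = 0" "b = 0"
proof -
  obtain p q where pq: "nonneg_poly p" "a = Fraction_Field.Fract p 1"
    "nonneg_poly q" "b = Fraction_Field.Fract q 1"
    using Nz_nonneg assms(1,2) by metis
  then have "p + q = 0"
    using assms(3) by (simp add: Fraction_Field.eq_fract Fraction_Field.Zero_fract_def)
  then have "Poly_Mapping.lookup p e + Poly_Mapping.lookup q e = 0" for e
    by (metis lookup_add lookup_zero)
  then have "Poly_Mapping.lookup p e = 0" for e
    using pq(1,3) unfolding nonneg_poly_def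
    by (metis add_nonneg_eq_0_iff)
  then have "p = 0"
    by (intro poly_mapping_eqI) simp
  with \<open>p + q = 0\<close> show "a = 0" "b = 0"
    by (simp_all add: pq Fraction_Field.Zero_fract_def)
qed

section \<open>Evaluation and closure properties of formal polynomials\<close>

definition expo_val :: "nat \<Rightarrow> (nat \<Rightarrow> ratfun) \<Rightarrow> (nat \<Rightarrow>\<^sub>0 nat) \<Rightarrow> ratfun" where
  "expo_val N x e = (\<Prod>i<N. x i ^ Poly_Mapping.lookup e i)"

lemma expo_val_0 [simp]: "expo_val N x 0 = 1"
  by (simp add: expo_val_def)

lemma expo_val_add: "expo_val N x (e + f) = expo_val N x e * expo_val N x f"
  by (simp add: expo_val_def lookup_add power_add prod.distrib)

text \<open>The support of a sum may shrink and that of a single term may be empty, so evaluations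
  are compared over a fixed finite set that contains all supports involved.\<close>

lemma fpoly_eval_superset:
  assumes "finite A" "Poly_Mapping.keys P \<subseteq> A"
  shows "fpoly_eval N x P = (\<Sum>e\<in>A. Poly_Mapping.lookup P e * expo_val N x e)"
  unfolding fpoly_eval_def expo_val_def
  by (rule sum.mono_neutral_left) (use assms in \<open>auto simp: in_keys_iff\<close>)

lemma fpoly_eval_0 [simp]: "fpoly_eval N x 0 = 0"
  by (simp add: fpoly_eval_def)

lemma fpoly_eval_add: "fpoly_eval N x (P + Q) = fpoly_eval N x P + fpoly_eval N x Q"
proof -
  let ?A = "Poly_Mapping.keys P \<union> Poly_Mapping.keys Q"
  show ?thesis
    using fpoly_eval_superset[of ?A P] fpoly_eval_superset[of ?A Q]
      fpoly_eval_superset[of ?A "P + Q"] keys_add[of P Q]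
    by (simp add: lookup_add algebra_simps sum.distrib)
qed

lemma fpoly_eval_single: "fpoly_eval N x (Poly_Mapping.single e c) = c * expo_val N x e"
  using fpoly_eval_superset[of "{e}" "Poly_Mapping.single e c" N x] by simp

lemma fpoly_eval_sum: "fpoly_eval N x (\<Sum>i\<in>I. f i) = (\<Sum>i\<in>I. fpoly_eval N x (f i))"
  by (induction I rule: infinite_finite_induct) (simp_all add: fpoly_eval_add)

lemma fpoly_eval_mult: "fpoly_eval N x (P * Q) = fpoly_eval N x P * fpoly_eval N x Q"
proof -
  have ev: "fpoly_eval N x R = (\<Sum>e\<in>Poly_Mapping.keys R. Poly_Mapping.lookup R e * expo_val N x e)" for R
    by (rule fpoly_eval_superset) auto
  show ?thesis
    unfolding ev[of P] ev[of Q] sum_product poly_mapping_mult_sum[of P Q]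
    by (simp add: fpoly_eval_sum fpoly_eval_single expo_val_add mult_ac)
qed

lemma fpoly_over_mono: "K \<subseteq> L \<Longrightarrow> fpoly_over N K \<subseteq> fpoly_over N L"
  by (auto simp: fpoly_over_def)

lemma fpoly_over_lookup:
  "subsemiring K \<Longrightarrow> P \<in> fpoly_over N K \<Longrightarrow> Poly_Mapping.lookup P e \<in> K"
  by (cases "e \<in> Poly_Mapping.keys P") (auto simp: fpoly_over_def in_keys_iff subsemiring_0)

lemma fpoly_over_0: "0 \<in> fpoly_over N K"
  by (simp add: fpoly_over_def)

lemma fpoly_over_add:
  assumes "subsemiring K" "P \<in> fpoly_over N K" "Q \<in> fpoly_over N K"
  shows "P + Q \<in> fpoly_over N K"
proof -
  have "Poly_Mapping.lookup (P + Q) e \<in> K" for e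
    unfolding lookup_add using assms by (intro subsemiring_add fpoly_over_lookup)
  moreover have "Poly_Mapping.keys e \<subseteq> {..<N}" if "e \<in> Poly_Mapping.keys (P + Q)" for e
    using that keys_add[of P Q] assms(2,3) unfolding fpoly_over_def by blast
  ultimately show ?thesis
    unfolding fpoly_over_def by blast
qed

lemma fpoly_over_single:
  "Poly_Mapping.keys e \<subseteq> {..<N} \<Longrightarrow> c \<in> K \<Longrightarrow> Poly_Mapping.single e c \<in> fpoly_over N K"
  by (auto simp: fpoly_over_def)

lemma fpoly_over_sum:
  "subsemiring K \<Longrightarrow> (\<And>i. i \<in> I \<Longrightarrow> f i \<in> fpoly_over N K) \<Longrightarrow> (\<Sum>i\<in>I. f i) \<in> fpoly_over N K"
  by (induction I rule: infinite_finite_induct) (auto intro: fpoly_over_0 fpoly_over_add)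

lemma fpoly_over_mult:
  assumes "subsemiring K" "P \<in> fpoly_over N K" "Q \<in> fpoly_over N K"
  shows "P * Q \<in> fpoly_over N K"
  unfolding poly_mapping_mult_sum[of P Q]
proof (intro fpoly_over_sum fpoly_over_single)
  fix a b assume "a \<in> Poly_Mapping.keys P" "b \<in> Poly_Mapping.keys Q"
  then show "Poly_Mapping.keys (a + b) \<subseteq> {..<N}"
    using assms(2,3) keys_add[of a b] unfolding fpoly_over_def by blast
  show "Poly_Mapping.lookup P a * Poly_Mapping.lookup Q b \<in> K"
    using assms by (intro subsemiring_mult fpoly_over_lookup)
qed (use assms in auto)

lemma fpoly_over_uminus:
  assumes "P \<in> fpoly_over N (Qz n r)"
  shows "- P \<in> fpoly_over N (Qz n r)"
  using assms by (auto simp: fpoly_over_def Qz_minus)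

text \<open>The cut-off at \<open>N\<close> makes any function a finitely supported exponent in the
  first \<open>N\<close> variables.\<close>

definition expo :: "nat \<Rightarrow> (nat \<Rightarrow> nat) \<Rightarrow> (nat \<Rightarrow>\<^sub>0 nat)" where
  "expo N f = Abs_poly_mapping (\<lambda>j. f j when j < N)"

lemma lookup_expo: "Poly_Mapping.lookup (expo N f) j = (f j when j < N)"
  unfolding expo_def
  by (subst lookup_Abs_poly_mapping)
     (auto simp: when_def intro: finite_subset[of _ "{..<N}"])

lemma keys_expo: "Poly_Mapping.keys (expo N f) \<subseteq> {..<N}"
  by (auto simp: in_keys_iff lookup_expo when_def split: if_splits)

lemma expo_eq_iff: "expo N f = expo N g \<longleftrightarrow> (\<forall>j<N. f j = g j)"
  by (auto simp: poly_mapping_eq_iff fun_eq_iff lookup_expo when_def)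

lemma expo_val_expo: "expo_val N x (expo N f) = (\<Prod>i<N. x i ^ f i)"
  by (simp add: expo_val_def lookup_expo)

text \<open>This clears denominators: multiplying by one power of all variables turns finitely many
  Laurent monomials into ordinary ones. The sum of all absolute values is a crude bound that serves
  every entry.\<close>

lemma ex_nat_shift:
  fixes f :: "'a \<Rightarrow> nat \<Rightarrow> int"
  assumes "finite A"
  shows "\<exists>N::nat. \<forall>a\<in>A. \<forall>i<n. 0 \<le> f a i + int N"
proof (intro exI ballI allI impI)
  fix a i assume "a \<in> A" "i < n"
  have "\<bar>f a i\<bar> \<le> (\<Sum>i<n. \<bar>f a i\<bar>)"
    using \<open>i < n\<close> by (intro member_le_sum) auto
  also have "\<dots> \<le> (\<Sum>a\<in>A. \<Sum>i<n. \<bar>f a i\<bar>)"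
    using \<open>a \<in> A\<close> assms by (intro member_le_sum) (auto intro: sum_nonneg)
  finally show "0 \<le> f a i + int (nat (\<Sum>a\<in>A. \<Sum>i<n. \<bar>f a i\<bar>))"
    by linarith
qed

subsection \<open>Tropical values of subtraction-free elements\<close>

text \<open>Over \<open>Nz\<close> no term of \<open>P + Q\<close> cancels, so its support is the
  union of the two supports, and the maximum over a union is the larger of the two maxima.\<close>

lemma max_weight_add:
  assumes P: "P \<in> fpoly_over m (Nz n r)" "P \<noteq> 0" and Q: "Q \<in> fpoly_over m (Nz n r)" "Q \<noteq> 0"
  shows "P + Q \<noteq> 0" "max_weight m w (P + Q) = max (max_weight m w P) (max_weight m w Q)"
proof -
  have "Poly_Mapping.keys (P + Q) = Poly_Mapping.keys P \<union> Poly_Mapping.keys Q"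
  proof (intro equalityI keys_add subsetI)
    fix e assume e: "e \<in> Poly_Mapping.keys P \<union> Poly_Mapping.keys Q"
    have "Poly_Mapping.lookup P e \<in> Nz n r" "Poly_Mapping.lookup Q e \<in> Nz n r"
      using P(1) Q(1) by (auto intro: fpoly_over_lookup subsemiring_Nz)
    note * = Nz_add_eq_0[OF this]
    show "e \<in> Poly_Mapping.keys (P + Q)"
      using e * unfolding in_keys_iff lookup_add Un_iff by blast
  qed
  moreover have "Poly_Mapping.keys P \<noteq> {}" "Poly_Mapping.keys Q \<noteq> {}"
    using P(2) Q(2) by simp_all
  ultimately show "P + Q \<noteq> 0" "max_weight m w (P + Q) = max (max_weight m w P) (max_weight m w Q)"
    unfolding max_weight_def keys_eq_empty[symmetric] by (simp_all add: image_Un Max_Un)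
qed

lemma exp_weight_0 [simp]: "exp_weight m w 0 = 0"
  by (simp add: exp_weight_def)

lemma max_weight_single: "c \<noteq> 0 \<Longrightarrow> max_weight m w (Poly_Mapping.single e c) = exp_weight m w e"
  by (simp add: max_weight_def)

lemma single_neq_0: "c \<noteq> 0 \<Longrightarrow> Poly_Mapping.single e c \<noteq> 0"
  by (metis lookup_single_eq lookup_zero)

text \<open>\<open>c\<close> is the value of the tropicalization of \<open>a\<close> in the max-plus semifield at \<open>x\<^sub>i = w\<^sub>i\<close>, \<open>z\<^sub>i\<^sub>,\<^sub>s = 0\<close>;
  it exists only if \<open>a\<close> is subtraction-free in \<open>x\<close>.\<close>

definition tropical_value ::
  "nat \<Rightarrow> (nat \<Rightarrow> nat) \<Rightarrow> nat \<Rightarrow> (nat \<Rightarrow> ratfun) \<Rightarrow> int vec \<Rightarrow> ratfun \<Rightarrow> int \<Rightarrow> bool" where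
  "tropical_value n r m x w a c \<longleftrightarrow> (\<exists>P Q. P \<in> fpoly_over m (Nz n r) \<and> Q \<in> fpoly_over m (Nz n r) \<and>
     P \<noteq> 0 \<and> Q \<noteq> 0 \<and> a = fpoly_eval m x P / fpoly_eval m x Q \<and>
     c = max_weight m w P - max_weight m w Q)"

locale independent_tuple =
  fixes n :: nat and r :: "nat \<Rightarrow> nat" and m :: nat and x :: "nat \<Rightarrow> ratfun"
  assumes alg_indep: "alg_independent (Qz n r) m x"
begin

abbreviation eval :: "fpoly \<Rightarrow> ratfun" where
  "eval \<equiv> fpoly_eval m x"

abbreviation val :: "int vec \<Rightarrow> ratfun \<Rightarrow> int \<Rightarrow> bool" where
  "val \<equiv> tropical_value n r m x"

lemma eval_inject:
  assumes "P \<in> fpoly_over m (Qz n r)" "Q \<in> fpoly_over m (Qz n r)" "eval P = eval Q"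
  shows "P = Q"
proof -
  have "eval (P + - Q) + eval Q = eval P"
    by (simp flip: fpoly_eval_add)
  then have "eval (P + - Q) = 0"
    using assms(3) by simp
  moreover have "P + - Q \<in> fpoly_over m (Qz n r)"
    using assms by (intro fpoly_over_add subsemiring_Qz fpoly_over_uminus)
  ultimately have "P + - Q = 0"
    using alg_indep unfolding alg_independent_def by blast
  then show ?thesis by simp
qed

lemma eval_nonzero:
  assumes "P \<in> fpoly_over m (Nz n r)" "P \<noteq> 0"
  shows "eval P \<noteq> 0"
  using assms eval_inject[of P 0] fpoly_over_mono[OF Nz_subset_Qz] fpoly_over_0 by auto

lemma val_nonzero: "val w a c \<Longrightarrow> a \<noteq> 0"
  unfolding tropical_value_def using eval_nonzero by auto

text \<open>Cross-multiplying two quotients for \<open>a\<close> gives polynomials with the same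
  evaluation. Algebraic independence makes them formally equal, and \<open>max_weight\<close> is
  additive on products.\<close>

lemma val_unique:
  assumes "val w a c" "val w a c'"
  shows "c = c'"
proof -
  obtain P Q where P: "P \<in> fpoly_over m (Nz n r)" "Q \<in> fpoly_over m (Nz n r)" "P \<noteq> 0" "Q \<noteq> 0"
    "a = eval P / eval Q" "c = max_weight m w P - max_weight m w Q"
    using assms(1) unfolding tropical_value_def by blast
  obtain P' Q' where P': "P' \<in> fpoly_over m (Nz n r)" "Q' \<in> fpoly_over m (Nz n r)" "P' \<noteq> 0" "Q' \<noteq> 0"
    "a = eval P' / eval Q'" "c' = max_weight m w P' - max_weight m w Q'"
    using assms(2) unfolding tropical_value_def by blast
  have "eval (P * Q') = eval (P' * Q)"
    using P P' by (simp add: fpoly_eval_mult eval_nonzero frac_eq_eq)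
  moreover have "P * Q' \<in> fpoly_over m (Qz n r)" "P' * Q \<in> fpoly_over m (Qz n r)"
    using P(1,2) P'(1,2) fpoly_over_mono[OF Nz_subset_Qz]
    by (auto intro!: fpoly_over_mult subsemiring_Qz)
  ultimately have "P * Q' = P' * Q"
    using eval_inject by blast
  then have "max_weight m w P + max_weight m w Q' = max_weight m w P' + max_weight m w Q"
    using max_weight_mult P P' by metis
  then show ?thesis
    using P(6) P'(6) by simp
qed

lemma val_var:
  assumes "i < m"
  shows "val w (x i) (w $ i)"
  unfolding tropical_value_def
proof (intro exI conjI)
  let ?e = "Poly_Mapping.single i (1::nat)"
  show "Poly_Mapping.single ?e 1 \<in> fpoly_over m (Nz n r)" "Poly_Mapping.single 0 1 \<in> fpoly_over m (Nz n r)"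
    using assms by (auto intro!: fpoly_over_single subsemiring_1 subsemiring_Nz simp del: single_one)
  show "Poly_Mapping.single ?e (1::ratfun) \<noteq> 0" "Poly_Mapping.single (0::nat \<Rightarrow>\<^sub>0 nat) (1::ratfun) \<noteq> 0"
    by (simp_all add: single_neq_0)
  have "expo_val m x ?e = (\<Prod>j<m. if j = i then x i else 1)"
    unfolding expo_val_def by (intro prod.cong) (auto simp: lookup_single when_def)
  then show "x i = eval (Poly_Mapping.single ?e 1) / eval (Poly_Mapping.single 0 1)"
    using assms by (simp add: fpoly_eval_single del: single_one)
  have "exp_weight m w ?e = (\<Sum>j<m. if j = i then w $ i else 0)"
    unfolding exp_weight_def by (intro sum.cong) (auto simp: lookup_single when_def)
  then show "w $ i = max_weight m w (Poly_Mapping.single ?e 1) - max_weight m w (Poly_Mapping.single 0 1)"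
    using assms by (simp add: max_weight_single del: single_one)
qed

lemma val_const:
  assumes "a \<in> Nz n r" "a \<noteq> 0"
  shows "val w a 0"
  unfolding tropical_value_def
proof (intro exI conjI)
  show "Poly_Mapping.single 0 a \<in> fpoly_over m (Nz n r)" "Poly_Mapping.single 0 1 \<in> fpoly_over m (Nz n r)"
    using assms by (auto intro!: fpoly_over_single subsemiring_1 subsemiring_Nz simp del: single_one)
qed (use assms in \<open>simp_all add: single_neq_0 fpoly_eval_single max_weight_single del: single_one\<close>)

lemma val_mult:
  assumes "val w a c" "val w b d"
  shows "val w (a * b) (c + d)"
proof -
  obtain P Q where P: "P \<in> fpoly_over m (Nz n r)" "Q \<in> fpoly_over m (Nz n r)" "P \<noteq> 0" "Q \<noteq> 0"
    "a = eval P / eval Q" "c = max_weight m w P - max_weight m w Q"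
    using assms(1) unfolding tropical_value_def by blast
  obtain P' Q' where P': "P' \<in> fpoly_over m (Nz n r)" "Q' \<in> fpoly_over m (Nz n r)" "P' \<noteq> 0" "Q' \<noteq> 0"
    "b = eval P' / eval Q'" "d = max_weight m w P' - max_weight m w Q'"
    using assms(2) unfolding tropical_value_def by blast
  show ?thesis
    unfolding tropical_value_def
  proof (rule exI[of _ "P * P'"], rule exI[of _ "Q * Q'"], intro conjI)
    show "a * b = eval (P * P') / eval (Q * Q')"
      by (simp add: P(5) P'(5) fpoly_eval_mult)
    show "c + d = max_weight m w (P * P') - max_weight m w (Q * Q')"
      by (simp add: P P' max_weight_mult)
  qed (simp_all add: P P' fpoly_over_mult subsemiring_Nz)
qed

lemma val_inverse:
  assumes "val w a c"
  shows "val w (inverse a) (- c)"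
proof -
  obtain P Q where P: "P \<in> fpoly_over m (Nz n r)" "Q \<in> fpoly_over m (Nz n r)" "P \<noteq> 0" "Q \<noteq> 0"
    "a = eval P / eval Q" "c = max_weight m w P - max_weight m w Q"
    using assms(1) unfolding tropical_value_def by blast
  show ?thesis
    unfolding tropical_value_def
    by (rule exI[of _ Q], rule exI[of _ P]) (simp add: P)
qed

lemma val_divide: "val w a c \<Longrightarrow> val w b d \<Longrightarrow> val w (a / b) (c - d)"
  using val_mult[of w a c "inverse b" "- d"] val_inverse[of w b d] by (simp add: divide_inverse)

lemma val_add:
  assumes "val w a c" "val w b d"
  shows "val w (a + b) (max c d)"
proof -
  obtain P Q where P: "P \<in> fpoly_over m (Nz n r)" "Q \<in> fpoly_over m (Nz n r)" "P \<noteq> 0" "Q \<noteq> 0"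
    "a = eval P / eval Q" "c = max_weight m w P - max_weight m w Q"
    using assms(1) unfolding tropical_value_def by blast
  obtain P' Q' where P': "P' \<in> fpoly_over m (Nz n r)" "Q' \<in> fpoly_over m (Nz n r)" "P' \<noteq> 0" "Q' \<noteq> 0"
    "b = eval P' / eval Q'" "d = max_weight m w P' - max_weight m w Q'"
    using assms(2) unfolding tropical_value_def by blast
  have *: "P * Q' \<in> fpoly_over m (Nz n r)" "P' * Q \<in> fpoly_over m (Nz n r)" "P * Q' \<noteq> 0" "P' * Q \<noteq> 0"
    using P P' by (auto intro: fpoly_over_mult subsemiring_Nz)
  show ?thesis
    unfolding tropical_value_def
  proof (rule exI[of _ "P * Q' + P' * Q"], rule exI[of _ "Q * Q'"], intro conjI)
    show "P * Q' + P' * Q \<noteq> 0"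
      using max_weight_add(1) * by blast
    show "a + b = eval (P * Q' + P' * Q) / eval (Q * Q')"
      unfolding fpoly_eval_add fpoly_eval_mult P(5) P'(5)
      using P(2,4) P'(2,4) by (simp add: add_frac_eq eval_nonzero)
    show "max c d = max_weight m w (P * Q' + P' * Q) - max_weight m w (Q * Q')"
      using max_weight_add(2)[OF *(1,3,2,4)] P P' by (simp add: max_weight_mult)
  qed (simp_all add: P P' * fpoly_over_mult fpoly_over_add subsemiring_Nz)
qed

lemma val_one: "val w 1 0"
  by (rule val_const) (auto intro: subsemiring_1 subsemiring_Nz)

lemma val_prod:
  "finite I \<Longrightarrow> (\<And>i. i \<in> I \<Longrightarrow> val w (a i) (c i)) \<Longrightarrow> val w (\<Prod>i\<in>I. a i) (\<Sum>i\<in>I. c i)"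
  by (induction I rule: finite_induct) (simp_all add: val_one val_mult)

lemma val_sum:
  assumes "finite I" "I \<noteq> {}" "\<And>i. i \<in> I \<Longrightarrow> val w (a i) (c i)"
  shows "val w (\<Sum>i\<in>I. a i) (Max (c ` I))"
  using assms by (induction I rule: finite_ne_induct) (simp_all add: val_add)

lemma val_power: "val w a c \<Longrightarrow> val w (a ^ k) (int k * c)"
proof (induction k)
  case 0
  show ?case by (simp add: val_one)
next
  case (Suc k)
  then have "val w (a * a ^ k) (c + int k * c)"
    by (intro val_mult) auto
  then show ?case by (simp add: distrib_right)
qed

lemma val_power_int:
  assumes "val w a c"
  shows "val w (a powi k) (k * c)"
proof (cases "k \<ge> 0")
  case True
  then show ?thesis
    using val_power[OF assms, of "nat k"] by (simp add: power_int_def)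
next
  case False
  then show ?thesis
    using val_power[OF val_inverse[OF assms], of "nat (- k)"] by (simp add: power_int_def)
qed

lemma val_laurent_monomial: "val w (laurent_monomial m x h) (\<Sum>i<m. h $ i * w $ i)"
  unfolding laurent_monomial_def by (intro val_prod val_power_int val_var) auto

lemma x_nonzero: "i < m \<Longrightarrow> x i \<noteq> 0"
  using val_var val_nonzero by blast

lemma laurent_monomial_nonzero: "laurent_monomial m x h \<noteq> 0"
  using val_laurent_monomial val_nonzero by blast

section \<open>Laurent monomials and uniqueness of Laurent expansions\<close>

lemma laurent_monomial_add:
  assumes "h \<in> carrier_vec m" "h' \<in> carrier_vec m"
  shows "laurent_monomial m x (h + h') = laurent_monomial m x h * laurent_monomial m x h'"
proof -
  have "x i powi (h + h') $ i = x i powi h $ i * x i powi h' $ i" if "i < m" for i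
    using assms that x_nonzero[of i] by (simp add: power_int_add)
  then show ?thesis
    unfolding laurent_monomial_def prod.distrib[symmetric] by (intro prod.cong) auto
qed

text \<open>Linear independence of Laurent monomials over \<open>Qz\<close>, reduced to polynomials
  by a common shift. Several indices may share an exponent, so the coefficient at \<open>h\<close>
  collects all of them.\<close>

lemma laurent_coeffs_eq_0:
  assumes I: "finite I" "\<And>i. i \<in> I \<Longrightarrow> \<phi> i \<in> carrier_vec m" "\<And>i. i \<in> I \<Longrightarrow> c i \<in> Qz n r"
    and 0: "(\<Sum>i\<in>I. c i * laurent_monomial m x (\<phi> i)) = 0"
  shows "(\<Sum>i\<in>I. c i when \<phi> i = h) = 0"
proof (cases "h \<in> \<phi> ` I")
  case h: True
  obtain N where N: "\<forall>i\<in>I. \<forall>j<m. 0 \<le> \<phi> i $ j + int N"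
    using ex_nat_shift[OF I(1), of m "\<lambda>i j. \<phi> i $ j"] by blast
  \<comment> \<open>\<open>nat\<close> truncates, so \<open>E\<close> separates only exponents that
    are nonnegative after the shift. \<open>h\<close> is among them because this case assumes that
    it is some \<open>\<phi> i\<close>.\<close>
  define E where "E v = expo m (\<lambda>j. nat (v $ j + int N))" for v :: "int vec"
  define P where "P = (\<Sum>i\<in>I. Poly_Mapping.single (E (\<phi> i)) (c i))"
  have "expo_val m x (E (\<phi> i)) = laurent_monomial m x (\<phi> i) * (\<Prod>j<m. x j ^ N)" if "i \<in> I" for i
  proof -
    have "x j ^ nat (\<phi> i $ j + int N) = x j powi \<phi> i $ j * x j ^ N" if "j < m" for j
      using N[rule_format, OF \<open>i \<in> I\<close> that] x_nonzero[OF that] power_int_add[of "x j" "\<phi> i $ j" "int N"]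
      by (simp add: power_int_def)
    then show ?thesis
      unfolding E_def expo_val_expo laurent_monomial_def prod.distrib[symmetric]
      by (intro prod.cong) auto
  qed
  then have "eval P = (\<Sum>i\<in>I. c i * laurent_monomial m x (\<phi> i)) * (\<Prod>j<m. x j ^ N)"
    unfolding P_def fpoly_eval_sum fpoly_eval_single sum_distrib_right
    by (intro sum.cong) (simp_all add: mult_ac)
  moreover have "P \<in> fpoly_over m (Qz n r)"
    unfolding P_def E_def
    by (intro fpoly_over_sum fpoly_over_single subsemiring_Qz I(3) keys_expo)
  ultimately have "P = 0"
    using 0 eval_inject[of P 0] by (simp add: fpoly_over_0)
  have "E (\<phi> i) = E h \<longleftrightarrow> \<phi> i = h" if "i \<in> I" for i
  proof
    assume "E (\<phi> i) = E h"
    then have "nat (\<phi> i $ j + int N) = nat (h $ j + int N)" if "j < m" for j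
      using that by (auto simp: E_def expo_eq_iff)
    moreover obtain i' where "i' \<in> I" "h = \<phi> i'"
      using h by blast
    ultimately have "\<phi> i $ j = h $ j" if "j < m" for j
      using N[rule_format, OF \<open>i \<in> I\<close> that] N[rule_format, of i' j] that by (metis add_right_cancel eq_nat_nat_iff)
    then show "\<phi> i = h"
      using I(2)[OF \<open>i \<in> I\<close>] I(2)[OF \<open>i' \<in> I\<close>] \<open>h = \<phi> i'\<close> by (intro eq_vecI) auto
  qed simp
  then have "(\<Sum>i\<in>I. c i when \<phi> i = h) = Poly_Mapping.lookup P (E h)"
    unfolding P_def lookup_sum lookup_single by (intro sum.cong) (auto simp: when_def)
  then show ?thesis
    using \<open>P = 0\<close> by simp
next
  case False
  then show ?thesis
    by (intro sum.neutral) (auto simp: when_def)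
qed

text \<open>The difference of the two expansions is a single vanishing combination indexed by the
  disjoint sum \<open>I <+> J\<close>, with the second family of coefficients negated.\<close>

lemma laurent_coeffs_unique:
  assumes I: "finite I" "\<And>i. i \<in> I \<Longrightarrow> \<phi> i \<in> carrier_vec m" "\<And>i. i \<in> I \<Longrightarrow> c i \<in> Qz n r"
    and J: "finite J" "\<And>j. j \<in> J \<Longrightarrow> \<psi> j \<in> carrier_vec m" "\<And>j. j \<in> J \<Longrightarrow> d j \<in> Qz n r"
    and eq: "(\<Sum>i\<in>I. c i * laurent_monomial m x (\<phi> i)) = (\<Sum>j\<in>J. d j * laurent_monomial m x (\<psi> j))"
  shows "(\<Sum>i\<in>I. c i when \<phi> i = h) = (\<Sum>j\<in>J. d j when \<psi> j = h)"
proof -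
  have "(\<Sum>k\<in>I <+> J. case_sum c (\<lambda>j. - d j) k when case_sum \<phi> \<psi> k = h) = 0"
  proof (rule laurent_coeffs_eq_0)
    show "(\<Sum>k\<in>I <+> J. case_sum c (\<lambda>j. - d j) k * laurent_monomial m x (case_sum \<phi> \<psi> k)) = 0"
      using eq by (simp add: sum.Plus I(1) J(1) sum_negf)
  qed (auto intro: Qz_minus[OF J(3)] I J)
  moreover have "(\<Sum>j\<in>J. - d j when \<psi> j = h) = - (\<Sum>j\<in>J. d j when \<psi> j = h)"
    unfolding sum_negf[symmetric] by (intro sum.cong) (auto simp: when_def)
  ultimately show ?thesis
    by (simp add: sum.Plus I(1) J(1))
qed

end

section \<open>Exponents as integer vectors\<close>

definition expo_vec :: "nat \<Rightarrow> (nat \<Rightarrow>\<^sub>0 nat) \<Rightarrow> int vec" where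
  "expo_vec N e = vec N (\<lambda>i. int (Poly_Mapping.lookup e i))"

lemma expo_vec_carrier [simp]: "expo_vec N e \<in> carrier_vec N"
  and dim_expo_vec [simp]: "dim_vec (expo_vec N e) = N"
  and index_expo_vec [simp]: "i < N \<Longrightarrow> expo_vec N e $ i = int (Poly_Mapping.lookup e i)"
  by (simp_all add: expo_vec_def)

lemma expo_vec_0: "expo_vec N 0 = 0\<^sub>v N"
  by (intro eq_vecI) auto

lemma expo_vec_inject:
  assumes "Poly_Mapping.keys e \<subseteq> {..<N}" "Poly_Mapping.keys f \<subseteq> {..<N}" "expo_vec N e = expo_vec N f"
  shows "e = f"
proof (rule poly_mapping_eqI)
  fix i
  show "Poly_Mapping.lookup e i = Poly_Mapping.lookup f i"
  proof (cases "i < N")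
    case True
    then show ?thesis
      using arg_cong[OF assms(3), of "\<lambda>v. v $ i"] by simp
  next
    case False
    then have "i \<notin> Poly_Mapping.keys e" "i \<notin> Poly_Mapping.keys f"
      using assms(1,2) by auto
    then show ?thesis
      by (simp add: in_keys_iff)
  qed
qed

lemma expo_val_eq_laurent: "expo_val N x e = laurent_monomial N x (expo_vec N e)"
  by (simp add: expo_val_def laurent_monomial_def)

lemma mat_vec_index:
  fixes A :: "'a::semiring_0 mat"
  assumes "A \<in> carrier_mat a b" "v \<in> carrier_vec b" "i < a"
  shows "(A *\<^sub>v v) $ i = (\<Sum>j<b. A $$ (i, j) * v $ j)"
  using assms by (simp add: scalar_prod_def atLeast0LessThan)

text \<open>Otherwise the simplifier would rewrite entries of matrix-vector products into scalar
  products of rows before the lemmas about them could apply.\<close>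

declare index_mult_mat_vec [simp del]

lemma scalar_prod_lessThan:
  "w \<in> carrier_vec N \<Longrightarrow> v \<bullet> w = (\<Sum>i<N. v $ i * w $ i)"
  by (simp add: scalar_prod_def atLeast0LessThan)

lemma diag_zero_carrier [simp]: "diag_zero n m d \<in> carrier_mat n m"
  by (simp add: diag_zero_def)

lemma diag_zero_mult_vec:
  assumes "n \<le> m" "g \<in> carrier_vec m"
  shows "diag_zero n m d *\<^sub>v g = vec n (\<lambda>k. d k * g $ k)"
proof (rule eq_vecI)
  fix k assume "k < dim_vec (vec n (\<lambda>k. d k * g $ k))"
  then have k: "k < n" by simp
  then have "(diag_zero n m d *\<^sub>v g) $ k = (\<Sum>j<m. diag_zero n m d $$ (k, j) * g $ j)"
    using assms by (intro mat_vec_index) auto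
  also have "\<dots> = (\<Sum>j<m. if j = k then d k * g $ k else 0)"
    using k by (intro sum.cong) (auto simp: diag_zero_def)
  also have "\<dots> = d k * g $ k"
    using k assms(1) by simp
  finally show "(diag_zero n m d *\<^sub>v g) $ k = vec n (\<lambda>k. d k * g $ k) $ k"
    using k by simp
qed (simp add: diag_zero_def)

subsection \<open>A single seed with a compatible matrix\<close>

locale compatible_seed = independent_tuple +
  fixes B \<Lambda> :: "int mat" and d :: "nat \<Rightarrow> int"
  assumes n_le_m: "n \<le> m"
    and B_carrier: "B \<in> carrier_mat m n"
    and L_carrier: "\<Lambda> \<in> carrier_mat m m"
    and compat: "transpose_mat B * \<Lambda> = diag_zero n m d"
    and d_pos: "\<And>k. k < n \<Longrightarrow> d k > 0"
begin

abbreviation y :: "nat \<Rightarrow> ratfun" where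
  "y \<equiv> yhat m x B"

abbreviation yeval :: "fpoly \<Rightarrow> ratfun" where
  "yeval \<equiv> fpoly_eval n y"

abbreviation xmon :: "int vec \<Rightarrow> ratfun" where
  "xmon \<equiv> laurent_monomial m x"

text \<open>Row \<open>k\<close> of the compatibility equation applied to \<open>g\<close>. The left
  side is the weight of \<open>y k\<close> when \<open>x i\<close> has weight
  \<open>(\<Lambda> *\<^sub>v g) $ i\<close>.\<close>

lemma column_weight:
  assumes "k < n" "g \<in> carrier_vec m"
  shows "(\<Sum>i<m. B $$ (i, k) * (\<Lambda> *\<^sub>v g) $ i) = d k * g $ k"
proof -
  have L: "\<Lambda> *\<^sub>v g \<in> carrier_vec m"
    using L_carrier assms(2) by simp
  have "(\<Sum>i<m. B $$ (i, k) * (\<Lambda> *\<^sub>v g) $ i) =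
      (\<Sum>i<m. transpose_mat B $$ (k, i) * (\<Lambda> *\<^sub>v g) $ i)"
    using B_carrier assms(1) by (intro sum.cong) auto
  also have "\<dots> = (transpose_mat B *\<^sub>v (\<Lambda> *\<^sub>v g)) $ k"
    using B_carrier L assms(1) by (intro mat_vec_index[symmetric]) auto
  also have "transpose_mat B *\<^sub>v (\<Lambda> *\<^sub>v g) = (transpose_mat B * \<Lambda>) *\<^sub>v g"
    using B_carrier L_carrier assms(2)
    by (intro assoc_mult_mat_vec[of _ n m _ m, symmetric]) simp_all
  also have "\<dots> = vec n (\<lambda>k. d k * g $ k)"
    unfolding compat using n_le_m assms(2) by (rule diag_zero_mult_vec)
  also have "\<dots> $ k = d k * g $ k"
    using assms(1) by simp
  finally show ?thesis .
qed

lemma B_index: "\<kappa> \<in> carrier_vec n \<Longrightarrow> i < m \<Longrightarrow> (B *\<^sub>v \<kappa>) $ i = (\<Sum>k<n. B $$ (i, k) * \<kappa> $ k)"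
  by (rule mat_vec_index[OF B_carrier])

lemma dim_B [simp]: "dim_row B = m" "dim_col B = n"
  using B_carrier by (rule carrier_matD)+

lemma dim_B_mult [simp]: "dim_vec (B *\<^sub>v \<kappa>) = m"
  by (simp only: dim_mult_mat_vec dim_B)

lemma B_mult_carrier [simp]: "B *\<^sub>v \<kappa> \<in> carrier_vec m"
  by (simp only: carrier_dim_vec dim_B_mult)

lemma B_mult_add:
  "\<kappa> \<in> carrier_vec n \<Longrightarrow> \<kappa>' \<in> carrier_vec n \<Longrightarrow> B *\<^sub>v (\<kappa> + \<kappa>') = B *\<^sub>v \<kappa> + B *\<^sub>v \<kappa>'"
  using B_carrier by (rule mult_add_distrib_mat_vec)

lemma lattice_weight:
  assumes "\<kappa> \<in> carrier_vec n" "g \<in> carrier_vec m"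
  shows "(\<Sum>i<m. (B *\<^sub>v \<kappa>) $ i * (\<Lambda> *\<^sub>v g) $ i) = (\<Sum>k<n. \<kappa> $ k * (d k * g $ k))"
proof -
  have "(\<Sum>i<m. (B *\<^sub>v \<kappa>) $ i * (\<Lambda> *\<^sub>v g) $ i) =
      (\<Sum>i<m. \<Sum>k<n. \<kappa> $ k * (B $$ (i, k) * (\<Lambda> *\<^sub>v g) $ i))"
    using assms(1) by (intro sum.cong refl) (simp add: B_index sum_distrib_left sum_distrib_right mult_ac)
  also have "\<dots> = (\<Sum>k<n. \<kappa> $ k * (\<Sum>i<m. B $$ (i, k) * (\<Lambda> *\<^sub>v g) $ i))"
    by (subst sum.swap) (simp add: sum_distrib_left)
  also have "\<dots> = (\<Sum>k<n. \<kappa> $ k * (d k * g $ k))"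
    using assms(2) by (intro sum.cong) (auto simp: column_weight)
  finally show ?thesis .
qed

text \<open>Pairing \<open>B *\<^sub>v \<kappa>\<close> with \<open>\<Lambda>\<close> applied to the
  unit vector at \<open>k\<close> returns \<open>\<kappa> $ k * d k\<close>, and \<open>d k\<close>
  is positive; so compatibility forces full column rank.\<close>

lemma B_inject:
  assumes "\<kappa> \<in> carrier_vec n" "\<kappa>' \<in> carrier_vec n" "B *\<^sub>v \<kappa> = B *\<^sub>v \<kappa>'"
  shows "\<kappa> = \<kappa>'"
proof (rule eq_vecI)
  fix k assume "k < dim_vec \<kappa>'"
  then have k: "k < n"
    using assms(2) by simp
  have *: "(\<Sum>j<n. \<mu> $ j * (d j * unit_vec m k $ j)) = \<mu> $ k * d k" for \<mu> :: "int vec"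
  proof -
    have "(\<Sum>j<n. \<mu> $ j * (d j * unit_vec m k $ j)) = (\<Sum>j<n. if j = k then \<mu> $ k * d k else 0)"
      using k n_le_m by (intro sum.cong) auto
    then show ?thesis
      using k by simp
  qed
  have "\<kappa> $ k * d k = \<kappa>' $ k * d k"
    using lattice_weight[OF assms(1) unit_vec_carrier, of k] lattice_weight[OF assms(2) unit_vec_carrier, of k]
    unfolding assms(3) * by linarith
  moreover have "d k \<noteq> 0"
    using d_pos[OF k] by simp
  ultimately show "\<kappa> $ k = \<kappa>' $ k"
    by simp
qed (use assms(1,2) in simp)

lemma power_int_sum: "i < m \<Longrightarrow> (\<Prod>k\<in>I. x i powi a k) = x i powi (\<Sum>k\<in>I. a k)"
proof (induction I rule: infinite_finite_induct)
  case (insert k I)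
  then show ?case
    using power_int_add[of "x i" "a k" "\<Sum>k\<in>I. a k"] x_nonzero[of i] by simp
qed simp_all

lemma y_monomial: "expo_val n y e = xmon (B *\<^sub>v expo_vec n e)"
proof -
  have "y k ^ Poly_Mapping.lookup e k =
      (\<Prod>i<m. x i powi (B $$ (i, k) * int (Poly_Mapping.lookup e k)))" if "k < n" for k
    using that B_carrier
    unfolding yhat_def laurent_monomial_def prod_power_distrib
    by (intro prod.cong) (auto simp: power_int_mult)
  then have "expo_val n y e = (\<Prod>k<n. \<Prod>i<m. x i powi (B $$ (i, k) * int (Poly_Mapping.lookup e k)))"
    unfolding expo_val_def by (intro prod.cong) auto
  also have "\<dots> = (\<Prod>i<m. \<Prod>k<n. x i powi (B $$ (i, k) * int (Poly_Mapping.lookup e k)))"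
    by (rule prod.swap)
  also have "\<dots> = xmon (B *\<^sub>v expo_vec n e)"
    unfolding laurent_monomial_def by (intro prod.cong) (auto simp: power_int_sum B_index)
  finally show ?thesis .
qed

lemma yeval_eq_sum:
  "yeval F = (\<Sum>e\<in>Poly_Mapping.keys F. Poly_Mapping.lookup F e * xmon (B *\<^sub>v expo_vec n e))"
  using fpoly_eval_superset[of "Poly_Mapping.keys F" F n y] by (simp add: y_monomial)

text \<open>By injectivity of \<open>B\<close>, distinct monomials in y are distinct Laurent
  monomials in x, and these are linearly independent.\<close>

lemma y_alg_independent: "alg_independent (Qz n r) n y"
  unfolding alg_independent_def
proof (intro ballI impI)
  fix F assume F: "F \<in> fpoly_over n (Qz n r)" "yeval F = 0"
  show "F = 0"
  proof (rule poly_mapping_eqI)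
    fix e
    show "Poly_Mapping.lookup F e = Poly_Mapping.lookup 0 e"
    proof (cases "e \<in> Poly_Mapping.keys F")
      case True
      have "B *\<^sub>v expo_vec n f = B *\<^sub>v expo_vec n e \<longleftrightarrow> f = e" if "f \<in> Poly_Mapping.keys F" for f
        using that True F(1) B_inject[OF expo_vec_carrier expo_vec_carrier]
        unfolding fpoly_over_def by (blast intro: expo_vec_inject)
      then have "(\<Sum>f\<in>Poly_Mapping.keys F. Poly_Mapping.lookup F f when B *\<^sub>v expo_vec n f = B *\<^sub>v expo_vec n e)
          = (\<Sum>f\<in>Poly_Mapping.keys F. Poly_Mapping.lookup F f when f = e)"
        by (intro sum.cong) auto
      also have "\<dots> = Poly_Mapping.lookup F e"
        using True by (simp add: when_def)
      moreover have "(\<Sum>f\<in>Poly_Mapping.keys F. Poly_Mapping.lookup F f when B *\<^sub>v expo_vec n f = B *\<^sub>v expo_vec n e) = 0"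
        by (rule laurent_coeffs_eq_0)
           (use F in \<open>auto simp: yeval_eq_sum fpoly_over_def\<close>)
      ultimately show ?thesis by simp
    qed (simp add: in_keys_iff)
  qed
qed

sublocale Y: independent_tuple n r n y
  by standard (rule y_alg_independent)

subsection \<open>The polynomial of a pointed element\<close>

text \<open>Antisymmetry of the dominance order comes from the linear functional \<open>f\<close> below, which by
  compatibility grows by \<open>\<Sum>\<^sub>k \<nu>\<^sub>k d\<^sub>k\<close> when \<open>B \<nu>\<close> is added.\<close>

lemma below_unique_maximal:
  assumes fin: "finite H" and H: "H \<subseteq> carrier_vec m"
    and max: "{h \<in> H. \<forall>h'\<in>H. dominance_le B h h' \<longrightarrow> h' = h} = {g}"
    and h: "h \<in> H"
  shows "dominance_le B h g"
proof -
  let ?one = "vec m (\<lambda>_. 1::int)"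
  define f where "f v = (\<Sum>i<m. v $ i * (\<Lambda> *\<^sub>v ?one) $ i)" for v :: "int vec"
  have f: "f (v + B *\<^sub>v map_vec int \<nu>) = f v + (\<Sum>k<n. int (\<nu> $ k) * d k)"
    if "v \<in> carrier_vec m" "\<nu> \<in> carrier_vec n" for v \<nu>
  proof -
    have "f (v + B *\<^sub>v map_vec int \<nu>) = f v + f (B *\<^sub>v map_vec int \<nu>)"
      unfolding f_def sum.distrib[symmetric]
      using that(1) by (intro sum.cong) (auto simp: distrib_right)
    also have "f (B *\<^sub>v map_vec int \<nu>) = (\<Sum>k<n. map_vec int \<nu> $ k * (d k * ?one $ k))"
      unfolding f_def by (rule lattice_weight) (use that in auto)
    finally show ?thesis
      using that(2) n_le_m by simp
  qed
  define A where "A = {h' \<in> H. dominance_le B h h'}"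
  have refl: "dominance_le B h h"
  proof -
    have "B *\<^sub>v map_vec int (0\<^sub>v n) = 0\<^sub>v m"
      using B_carrier by (intro eq_vecI) (auto simp: B_index)
    then show ?thesis
      unfolding dominance_le_def dim_B(2)
      by (intro exI[of _ "0\<^sub>v n"]) (use h H in auto)
  qed
  have "finite A" "A \<noteq> {}"
    using fin h refl by (auto simp: A_def)
  \<comment> \<open>Going up in the order lowers \<open>f\<close>, so an element of least
    \<open>f\<close> among those above \<open>h\<close> is maximal in all of \<open>H\<close>. It is
    therefore \<open>g\<close>.\<close>
  then obtain h0 where h0: "h0 \<in> A" "\<And>h'. h' \<in> A \<Longrightarrow> f h0 \<le> f h'"
    using arg_min_if_finite(1)[of A f] arg_min_least[of A _ f] by blast
  have "h' = h0" if h': "h' \<in> H" "dominance_le B h0 h'" for h'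
  proof -
    obtain \<nu> where \<nu>: "\<nu> \<in> carrier_vec n" "h0 = h' + B *\<^sub>v map_vec int \<nu>"
      using h'(2) unfolding dominance_le_def dim_B(2) by blast
    obtain \<mu> where \<mu>: "\<mu> \<in> carrier_vec n" "h = h0 + B *\<^sub>v map_vec int \<mu>"
      using h0(1) unfolding A_def dominance_le_def dim_B(2) by blast
    have "h = h' + B *\<^sub>v map_vec int (\<nu> + \<mu>)"
    proof -
      have "map_vec int (\<nu> + \<mu>) = map_vec int \<nu> + map_vec int \<mu>"
        using \<nu>(1) \<mu>(1) by (intro eq_vecI) auto
      then show ?thesis
        using \<nu> \<mu> h'(1) H by (simp add: B_mult_add assoc_add_vec[of _ m] subset_iff)
    qed
    moreover have "\<nu> + \<mu> \<in> carrier_vec n"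
      using \<nu>(1) \<mu>(1) by simp
    ultimately have "h' \<in> A"
      using h'(1) unfolding A_def dominance_le_def dim_B(2) by blast
    then have "(\<Sum>k<n. int (\<nu> $ k) * d k) \<le> 0"
      using h0(2)[of h'] f[of h' \<nu>] \<nu> h'(1) H by auto
    moreover have nn: "0 \<le> int (\<nu> $ k) * d k" if "k < n" for k
      using d_pos[OF that] by simp
    ultimately have "(\<Sum>k<n. int (\<nu> $ k) * d k) = 0"
      by (intro antisym sum_nonneg) auto
    then have "int (\<nu> $ k) * d k = 0" if "k < n" for k
      using that nn by (subst (asm) sum_nonneg_eq_0_iff) auto
    note * = this
    have "\<nu> $ k = 0" if "k < n" for k
      using *[OF that] d_pos[OF that] by simp
    then have "B *\<^sub>v map_vec int \<nu> = 0\<^sub>v m"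
      using \<nu>(1) by (intro eq_vecI) (auto simp: B_index)
    then show ?thesis
      using \<nu>(2) h'(1) H by auto
  qed
  then have "h0 \<in> {h \<in> H. \<forall>h'\<in>H. dominance_le B h h' \<longrightarrow> h' = h}"
    using h0(1) unfolding A_def by blast
  then have "h0 = g"
    using max by blast
  then show ?thesis
    using h0(1) by (simp add: A_def)
qed

text \<open>Every exponent lies below \<open>g\<close>, so dividing by the leading monomial leaves
  exponents \<open>B *\<^sub>v \<nu>\<close> with natural entries, which are monomials in y.
  Injectivity of \<open>B\<close> ensures that the constant term comes from \<open>g\<close>
  alone.\<close>

lemma pointed_polynomial:
  assumes fin: "finite {h. b h \<noteq> 0}" and H: "{h. b h \<noteq> 0} \<subseteq> carrier_vec m"
    and b: "range b \<subseteq> Zz n r" "b g = 1"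
    and max: "{h. b h \<noteq> 0 \<and> (\<forall>h'. b h' \<noteq> 0 \<and> dominance_le B h h' \<longrightarrow> h' = h)} = {g}"
  shows "\<exists>F \<in> fpoly_over n (Zz n r). Poly_Mapping.lookup F 0 = 1 \<and>
    (\<Sum>h | b h \<noteq> 0. b h * xmon h) = xmon g * yeval F"
proof -
  let ?H = "{h. b h \<noteq> 0}"
  have g: "g \<in> ?H" "g \<in> carrier_vec m"
    using b(2) H by auto
  have "{h \<in> ?H. \<forall>h'\<in>?H. dominance_le B h h' \<longrightarrow> h' = h} =
      {h. b h \<noteq> 0 \<and> (\<forall>h'. b h' \<noteq> 0 \<and> dominance_le B h h' \<longrightarrow> h' = h)}"
    by blast
  then have "dominance_le B h g" if "h \<in> ?H" for h
    using below_unique_maximal[OF fin H _ that] max by simp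
  then have "\<exists>\<nu>. h \<in> ?H \<longrightarrow> \<nu> \<in> carrier_vec n \<and> h = g + B *\<^sub>v map_vec int \<nu>" for h
    unfolding dominance_le_def dim_B(2) by blast
  then obtain \<nu> where \<nu>: "\<nu> h \<in> carrier_vec n" "h = g + B *\<^sub>v map_vec int (\<nu> h)" if "h \<in> ?H" for h
    by metis
  define E where "E h = expo n (\<lambda>i. \<nu> h $ i)" for h
  have E_vec: "expo_vec n (E h) = map_vec int (\<nu> h)" if "h \<in> ?H" for h
    using \<nu>(1)[OF that] by (intro eq_vecI) (auto simp: E_def lookup_expo)
  define F where "F = (\<Sum>h\<in>?H. Poly_Mapping.single (E h) (b h))"
  have "F \<in> fpoly_over n (Zz n r)"
    unfolding F_def E_def
    using b(1) by (intro fpoly_over_sum fpoly_over_single subsemiring_Zz keys_expo) auto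
  moreover have "xmon g * yeval F = (\<Sum>h\<in>?H. b h * xmon h)"
    unfolding F_def fpoly_eval_sum fpoly_eval_single y_monomial sum_distrib_left
  proof (intro sum.cong refl)
    fix h assume h: "h \<in> ?H"
    then have "xmon h = xmon g * xmon (B *\<^sub>v expo_vec n (E h))"
      using \<nu>(2)[OF h] laurent_monomial_add[OF g(2), of "B *\<^sub>v expo_vec n (E h)"] E_vec[OF h]
      by simp
    then show "xmon g * (b h * xmon (B *\<^sub>v expo_vec n (E h))) = b h * xmon h"
      by simp
  qed
  moreover have "Poly_Mapping.lookup F 0 = 1"
  proof -
    have "E h = 0 \<longleftrightarrow> h = g" if h: "h \<in> ?H" for h
    proof
      assume "E h = 0"
      then have "map_vec int (\<nu> h) = 0\<^sub>v n"
        using E_vec[OF h] by (simp add: expo_vec_0)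
      moreover have "B *\<^sub>v 0\<^sub>v n = 0\<^sub>v m"
        using B_carrier by (intro eq_vecI) (auto simp: B_index)
      ultimately show "h = g"
        using \<nu>(2)[OF h] g(2) by simp
    next
      assume "h = g"
      then have "g = g + B *\<^sub>v expo_vec n (E h)"
        using \<nu>(2)[OF h] E_vec[OF h] by simp
      then have "(B *\<^sub>v expo_vec n (E h)) $ i = 0" if "i < m" for i
        using arg_cong[of g _ "\<lambda>v. v $ i"] that g(2)
        by (metis add_cancel_right_right carrier_vecD dim_B_mult index_add_vec(1))
      then have "B *\<^sub>v expo_vec n (E h) = B *\<^sub>v 0\<^sub>v n"
        by (intro eq_vecI) (auto simp: B_index)
      then have "expo_vec n (E h) = expo_vec n 0"
        unfolding expo_vec_0 using B_inject[of "expo_vec n (E h)" "0\<^sub>v n"] by simp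
      then show "E h = 0"
        by (rule expo_vec_inject[of _ n, rotated 2]) (simp_all add: E_def keys_expo)
    qed
    hence "Poly_Mapping.lookup F 0 = (\<Sum>h\<in>?H. b h when h = g)"
      unfolding F_def lookup_sum lookup_single by (intro sum.cong) auto
    also have "\<dots> = 1"
      using g(1) fin b(2) by (simp add: when_def)
    finally show ?thesis .
  qed
  ultimately show ?thesis
    by (intro bexI[of _ F] conjI) simp_all
qed

text \<open>This makes the definite description in \<open>deg\<close> meaningful: the expansion
  determines the set of its maximal exponents.\<close>

lemma pointed_coeffs_unique:
  assumes "finite {h. b h \<noteq> 0}" "{h. b h \<noteq> 0} \<subseteq> carrier_vec m" "range b \<subseteq> Zz n r"
    and "finite {h. b' h \<noteq> 0}" "{h. b' h \<noteq> 0} \<subseteq> carrier_vec m" "range b' \<subseteq> Zz n r"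
    and "(\<Sum>h | b h \<noteq> 0. b h * xmon h) = (\<Sum>h | b' h \<noteq> 0. b' h * xmon h)"
  shows "b = b'"
proof
  fix h0
  have "(\<Sum>h | b h \<noteq> 0. b h when h = h0) = (\<Sum>h | b' h \<noteq> 0. b' h when h = h0)"
  proof (rule laurent_coeffs_unique)
    show "b h \<in> Qz n r" "b' h \<in> Qz n r" for h
      using assms(3,6) Zz_subset_Qz by blast+
  qed (use assms(1,2,4,5,7) in auto)
  then show "b h0 = b' h0"
    using assms(1,4) by (simp add: when_def split: if_split_asm)
qed

end

section \<open>From quotients in x to quotients in y\<close>

lemma vec_eq_carrier_iff:
  "v \<in> carrier_vec N \<Longrightarrow> w \<in> carrier_vec N \<Longrightarrow> v = w \<longleftrightarrow> (\<forall>i<N. v $ i = w $ i)"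
  by auto

context compatible_seed
begin

text \<open>The uniqueness behind the definite description in \<open>F_poly\<close>.\<close>

lemma y_polynomial_unique:
  assumes "F \<in> fpoly_over n (Zz n r)" "F' \<in> fpoly_over n (Zz n r)"
    and "xmon g * yeval F = xmon g * yeval F'"
  shows "F = F'"
proof (rule Y.eval_inject)
  show "F \<in> fpoly_over n (Qz n r)" "F' \<in> fpoly_over n (Qz n r)"
    using assms(1,2) fpoly_over_mono[OF Zz_subset_Qz] by blast+
  show "yeval F = yeval F'"
    using assms(3) laurent_monomial_nonzero by simp
qed

text \<open>From \<open>x\<^sup>g F(y) Q(x) = P(x)\<close>, keep only the terms of \<open>Q\<close> whose exponents lie in one coset of the
  lattice \<open>B \<int>\<^sup>n\<close>, and the terms of \<open>P\<close> in the coset shifted by \<open>g\<close>.  Up to a monomial these parts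
  are Laurent polynomials in \<open>y\<close> with the same coefficients.\<close>

lemma subtraction_free_quotient:
  assumes F: "F \<in> fpoly_over n (Qz n r)" "F \<noteq> 0" and g: "g \<in> carrier_vec m"
    and val: "val w (xmon g * yeval F) c"
  obtains P Q where "P \<in> fpoly_over n (Nz n r)" "Q \<in> fpoly_over n (Nz n r)" "P \<noteq> 0" "Q \<noteq> 0" "F * Q = P"
proof -
  obtain P Q where P: "P \<in> fpoly_over m (Nz n r)" and Q: "Q \<in> fpoly_over m (Nz n r)" "Q \<noteq> 0"
    and eq: "xmon g * yeval F = eval P / eval Q"
    using val unfolding tropical_value_def by blast
  have evals: "eval R = (\<Sum>e\<in>Poly_Mapping.keys R. Poly_Mapping.lookup R e * xmon (expo_vec m e))" for R
    using fpoly_eval_superset[of "Poly_Mapping.keys R" R m x] by (simp add: expo_val_eq_laurent)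
  define prod_expo where "prod_expo p = g + B *\<^sub>v expo_vec n (fst p) + expo_vec m (snd p)" for p
  define prod_coeff where "prod_coeff p = Poly_Mapping.lookup F (fst p) * Poly_Mapping.lookup Q (snd p)" for p
  have "(\<Sum>p\<in>Poly_Mapping.keys F \<times> Poly_Mapping.keys Q. prod_coeff p * xmon (prod_expo p)) =
      (\<Sum>e\<in>Poly_Mapping.keys P. Poly_Mapping.lookup P e * xmon (expo_vec m e))"
  proof -
    have "(\<Sum>p\<in>Poly_Mapping.keys F \<times> Poly_Mapping.keys Q. prod_coeff p * xmon (prod_expo p)) =
        (\<Sum>p\<in>Poly_Mapping.keys F \<times> Poly_Mapping.keys Q. xmon g *
          ((Poly_Mapping.lookup F (fst p) * xmon (B *\<^sub>v expo_vec n (fst p))) *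
           (Poly_Mapping.lookup Q (snd p) * xmon (expo_vec m (snd p)))))"
      unfolding prod_coeff_def prod_expo_def using g
      by (intro sum.cong refl) (simp add: laurent_monomial_add)
    also have "\<dots> = xmon g * (yeval F * eval Q)"
      unfolding yeval_eq_sum evals[of Q] sum_product sum.cartesian_product
      by (simp add: case_prod_unfold sum_distrib_left)
    also have "\<dots> = eval P"
      using eq eval_nonzero[OF Q] by (simp add: field_simps)
    finally show ?thesis
      unfolding evals[of P] .
  qed
  then have coeffs: "(\<Sum>p\<in>Poly_Mapping.keys F \<times> Poly_Mapping.keys Q. prod_coeff p when prod_expo p = h) =
      (\<Sum>e\<in>Poly_Mapping.keys P. Poly_Mapping.lookup P e when expo_vec m e = h)" for h
  proof (rule laurent_coeffs_unique[rotated -1])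
    show "prod_coeff p \<in> Qz n r" "Poly_Mapping.lookup P e \<in> Qz n r" for p e
      using fpoly_over_lookup[OF subsemiring_Nz P, of e] fpoly_over_lookup[OF subsemiring_Nz Q(1), of "snd p"]
        fpoly_over_lookup[OF subsemiring_Qz F(1), of "fst p"] Nz_subset_Qz
      unfolding prod_coeff_def by (auto intro: subsemiring_mult[OF subsemiring_Qz])
    show "prod_expo p \<in> carrier_vec m" for p
      using g by (simp add: prod_expo_def)
  qed simp_all
  \<comment> \<open>The coset is taken through an exponent that occurs in \<open>Q\<close>, which
    keeps the selected part of \<open>Q\<close> nonzero.\<close>
  obtain e0 where e0: "e0 \<in> Poly_Mapping.keys Q"
    using Q(2) by (metis all_not_in_conv keys_eq_empty)
  define J where "J = {e \<in> Poly_Mapping.keys Q. \<exists>\<kappa>\<in>carrier_vec n. expo_vec m e = expo_vec m e0 + B *\<^sub>v \<kappa>}"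
  define J' where "J' = {e \<in> Poly_Mapping.keys P. \<exists>\<kappa>\<in>carrier_vec n. expo_vec m e = expo_vec m e0 + g + B *\<^sub>v \<kappa>}"
  have fin: "finite J" "finite J'"
    by (simp_all add: J_def J'_def)
  have "\<forall>e\<in>J. \<exists>\<kappa>. \<kappa> \<in> carrier_vec n \<and> expo_vec m e = expo_vec m e0 + B *\<^sub>v \<kappa>"
    unfolding J_def by blast
  then obtain \<kappa> where \<kappa>: "\<kappa> e \<in> carrier_vec n" "expo_vec m e = expo_vec m e0 + B *\<^sub>v \<kappa> e" if "e \<in> J" for e
    by metis
  have "\<forall>e\<in>J'. \<exists>\<kappa>. \<kappa> \<in> carrier_vec n \<and> expo_vec m e = expo_vec m e0 + g + B *\<^sub>v \<kappa>"
    unfolding J'_def by blast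
  then obtain \<kappa>' where \<kappa>': "\<kappa>' e \<in> carrier_vec n" "expo_vec m e = expo_vec m e0 + g + B *\<^sub>v \<kappa>' e" if "e \<in> J'" for e
    by metis
  obtain N1 N2 where N: "\<forall>e\<in>J. \<forall>i<n. 0 \<le> \<kappa> e $ i + int N1" "\<forall>e\<in>J'. \<forall>i<n. 0 \<le> \<kappa>' e $ i + int N2"
    using ex_nat_shift[OF fin(1), of n "\<lambda>e i. \<kappa> e $ i"] ex_nat_shift[OF fin(2), of n "\<lambda>e i. \<kappa>' e $ i"]
    by blast
  \<comment> \<open>Both parts get the same shift: it multiplies them by one common monomial in y
    and so preserves the identity between them.\<close>
  define N where "N = N1 + N2"
  define E where "E v = expo n (\<lambda>i. nat (v $ i + int N))" for v :: "int vec"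
  have E: "a + E v = \<nu> \<longleftrightarrow> expo_vec n a + v = expo_vec n \<nu> + vec n (\<lambda>_. - int N)"
    if "v \<in> carrier_vec n" "\<forall>i<n. 0 \<le> v $ i + int N" "Poly_Mapping.keys a \<subseteq> {..<n}" "Poly_Mapping.keys \<nu> \<subseteq> {..<n}"
    for a v \<nu>
  proof -
    have "Poly_Mapping.keys (a + E v) \<subseteq> {..<n}"
      using that(3) keys_add[of a "E v"] keys_expo[of n] unfolding E_def by blast
    then have "a + E v = \<nu> \<longleftrightarrow> expo_vec n (a + E v) = expo_vec n \<nu>"
      using that(4) by (auto intro: expo_vec_inject)
    also have "\<dots> \<longleftrightarrow> (\<forall>i<n. expo_vec n a $ i + (v $ i + int N) = expo_vec n \<nu> $ i)"
      using that(2) by (simp add: vec_eq_carrier_iff[of _ n] lookup_add E_def lookup_expo)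
    also have "\<dots> \<longleftrightarrow> expo_vec n a + v = expo_vec n \<nu> + vec n (\<lambda>_. - int N)"
      using that(1) by (auto simp: vec_eq_carrier_iff[of _ n] algebra_simps)
    finally show ?thesis .
  qed
  have shift: "\<forall>i<n. 0 \<le> \<kappa> e $ i + int N" if "e \<in> J" for e
    using N(1) that unfolding N_def by fastforce
  have shift': "\<forall>i<n. 0 \<le> \<kappa>' e $ i + int N" if "e \<in> J'" for e
    using N(2) that unfolding N_def by fastforce
  define Q' where "Q' = (\<Sum>e\<in>J. Poly_Mapping.single (E (\<kappa> e)) (Poly_Mapping.lookup Q e))"
  define P' where "P' = (\<Sum>e\<in>J'. Poly_Mapping.single (E (\<kappa>' e)) (Poly_Mapping.lookup P e))"
  have Q'_over: "Q' \<in> fpoly_over n (Nz n r)" and P'_over: "P' \<in> fpoly_over n (Nz n r)"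
    unfolding Q'_def P'_def E_def
    by (intro fpoly_over_sum fpoly_over_single subsemiring_Nz keys_expo
        fpoly_over_lookup[OF subsemiring_Nz P] fpoly_over_lookup[OF subsemiring_Nz Q(1)])+
  have FQ'_over: "F * Q' \<in> fpoly_over n (Qz n r)"
    using F(1) Q'_over fpoly_over_mono[OF Nz_subset_Qz]
    by (intro fpoly_over_mult subsemiring_Qz) auto
  have F_keys: "Poly_Mapping.keys a \<subseteq> {..<n}" if "a \<in> Poly_Mapping.keys F" for a
    using F(1) that by (simp add: fpoly_over_def)
  have "F * Q' = P'"
  proof (rule poly_mapping_eqI)
    fix \<nu>
    show "Poly_Mapping.lookup (F * Q') \<nu> = Poly_Mapping.lookup P' \<nu>"
    proof (cases "Poly_Mapping.keys \<nu> \<subseteq> {..<n}")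
      case False
      then have "\<nu> \<notin> Poly_Mapping.keys (F * Q')" "\<nu> \<notin> Poly_Mapping.keys P'"
        using FQ'_over P'_over unfolding fpoly_over_def by blast+
      then show ?thesis
        by (simp add: in_keys_iff)
    next
      case \<nu>: True
      \<comment> \<open>\<open>\<mu>\<close> is the exponent \<open>\<nu>\<close> before the shift,
        and \<open>h\<close> is the exponent in x of the corresponding terms of the product.\<close>
      define \<mu> where "\<mu> = expo_vec n \<nu> + vec n (\<lambda>_. - int N)"
      define h where "h = expo_vec m e0 + g + B *\<^sub>v \<mu>"
      have \<mu>: "\<mu> \<in> carrier_vec n"
        by (simp add: \<mu>_def)
      have iff: "a + E (\<kappa> e) = \<nu> \<longleftrightarrow> prod_expo (a, e) = h"
        if a: "a \<in> Poly_Mapping.keys F" and e: "e \<in> J" for a e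
      proof -
        have "a + E (\<kappa> e) = \<nu> \<longleftrightarrow> expo_vec n a + \<kappa> e = \<mu>"
          unfolding \<mu>_def by (rule E) (use \<kappa>[OF e] shift[OF e] F_keys[OF a] \<nu> in auto)
        also have "\<dots> \<longleftrightarrow> B *\<^sub>v (expo_vec n a + \<kappa> e) = B *\<^sub>v \<mu>"
          using B_inject[of "expo_vec n a + \<kappa> e" \<mu>] \<mu> \<kappa>(1)[OF e] by auto
        also have "\<dots> \<longleftrightarrow> B *\<^sub>v expo_vec n a + B *\<^sub>v \<kappa> e = B *\<^sub>v \<mu>"
          using \<kappa>(1)[OF e] by (simp add: B_mult_add)
        also have "\<dots> \<longleftrightarrow> prod_expo (a, e) = h"
          using g unfolding prod_expo_def h_def fst_conv snd_conv \<kappa>(2)[OF e]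
          by (auto simp: vec_eq_carrier_iff[of _ m])
        finally show ?thesis .
      qed
      \<comment> \<open>Multiplying by a monomial in y stays inside a coset, so terms of
        \<open>Q\<close> from other cosets cannot contribute at \<open>h\<close>.\<close>
      have outside: "prod_expo (a, e) \<noteq> h" if e: "e \<in> Poly_Mapping.keys Q - J" for a e
      proof
        assume "prod_expo (a, e) = h"
        moreover have "B *\<^sub>v \<mu> = B *\<^sub>v expo_vec n a + B *\<^sub>v (\<mu> - expo_vec n a)"
        proof -
          have "\<mu> = expo_vec n a + (\<mu> - expo_vec n a)"
            using \<mu> by (intro eq_vecI) auto
          then show ?thesis
            using B_mult_add[of "expo_vec n a" "\<mu> - expo_vec n a"] \<mu> by simp
        qed
        ultimately have "expo_vec m e = expo_vec m e0 + B *\<^sub>v (\<mu> - expo_vec n a)"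
          using g unfolding prod_expo_def h_def fst_conv snd_conv
          by (auto simp: vec_eq_carrier_iff[of _ m])
        moreover have "\<mu> - expo_vec n a \<in> carrier_vec n"
          using \<mu> by simp
        ultimately have "e \<in> J"
          using e unfolding J_def by blast
        then show False
          using e by blast
      qed
      have "Poly_Mapping.lookup (F * Q') \<nu> =
          (\<Sum>a\<in>Poly_Mapping.keys F. \<Sum>e\<in>J. prod_coeff (a, e) when a + E (\<kappa> e) = \<nu>)"
      proof -
        have "F * Q' = (\<Sum>a\<in>Poly_Mapping.keys F. Poly_Mapping.single a (Poly_Mapping.lookup F a)) * Q'"
          by (simp only: poly_mapping_sum_single[symmetric])
        also have "\<dots> = (\<Sum>a\<in>Poly_Mapping.keys F. \<Sum>e\<in>J. Poly_Mapping.single (a + E (\<kappa> e)) (prod_coeff (a, e)))"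
          unfolding Q'_def sum_product mult_single prod_coeff_def fst_conv snd_conv ..
        finally show ?thesis
          by (simp add: lookup_sum lookup_single)
      qed
      also have "\<dots> = (\<Sum>a\<in>Poly_Mapping.keys F. \<Sum>e\<in>J. prod_coeff (a, e) when prod_expo (a, e) = h)"
        by (intro sum.cong refl) (simp add: iff)
      also have "\<dots> = (\<Sum>a\<in>Poly_Mapping.keys F. \<Sum>e\<in>Poly_Mapping.keys Q. prod_coeff (a, e) when prod_expo (a, e) = h)"
        by (intro sum.cong refl sum.mono_neutral_left) (auto simp: J_def outside)
      also have "\<dots> = (\<Sum>p\<in>Poly_Mapping.keys F \<times> Poly_Mapping.keys Q. prod_coeff p when prod_expo p = h)"
        by (simp add: sum.cartesian_product case_prod_unfold)
      also have "\<dots> = (\<Sum>e\<in>Poly_Mapping.keys P. Poly_Mapping.lookup P e when expo_vec m e = h)"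
        by (rule coeffs)
      also have "\<dots> = (\<Sum>e\<in>J'. Poly_Mapping.lookup P e when expo_vec m e = h)"
        using \<mu> by (intro sum.mono_neutral_right) (auto simp: J'_def h_def when_def)
      also have "\<dots> = (\<Sum>e\<in>J'. Poly_Mapping.lookup P e when E (\<kappa>' e) = \<nu>)"
      proof (intro sum.cong refl)
        fix e assume e: "e \<in> J'"
        have "E (\<kappa>' e) = \<nu> \<longleftrightarrow> expo_vec n 0 + \<kappa>' e = \<mu>"
          unfolding \<mu>_def using E[of "\<kappa>' e" 0 \<nu>] \<kappa>'[OF e] shift'[OF e] \<nu> by simp
        also have "\<dots> \<longleftrightarrow> \<kappa>' e = \<mu>"
          using \<kappa>'(1)[OF e] by (simp add: expo_vec_0)
        also have "\<dots> \<longleftrightarrow> B *\<^sub>v \<kappa>' e = B *\<^sub>v \<mu>"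
          using B_inject[of "\<kappa>' e" \<mu>] \<mu> \<kappa>'(1)[OF e] by auto
        also have "\<dots> \<longleftrightarrow> expo_vec m e = h"
          using g unfolding h_def \<kappa>'(2)[OF e] by (auto simp: vec_eq_carrier_iff[of _ m])
        finally show "(Poly_Mapping.lookup P e when expo_vec m e = h) = (Poly_Mapping.lookup P e when E (\<kappa>' e) = \<nu>)"
          by simp
      qed
      also have "\<dots> = Poly_Mapping.lookup P' \<nu>"
        unfolding P'_def lookup_sum lookup_single ..
      finally show ?thesis .
    qed
  qed
  moreover have "Q' \<noteq> 0"
  proof -
    have "expo_vec m e0 = expo_vec m e0 + B *\<^sub>v 0\<^sub>v n"
      by (auto simp: vec_eq_carrier_iff[of _ m] B_index)
    then have "e0 \<in> J"
      using e0 unfolding J_def by force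
    have "E (\<kappa> e) = E (\<kappa> e0) \<longleftrightarrow> e = e0" if "e \<in> J" for e
    proof
      assume eq: "E (\<kappa> e) = E (\<kappa> e0)"
      have "expo_vec n 0 + \<kappa> e = expo_vec n (E (\<kappa> e0)) + vec n (\<lambda>_. - int N)"
        using E[of "\<kappa> e" 0 "E (\<kappa> e0)"] \<kappa>[OF that] shift[OF that] eq by (simp add: E_def keys_expo)
      moreover have "expo_vec n 0 + \<kappa> e0 = expo_vec n (E (\<kappa> e0)) + vec n (\<lambda>_. - int N)"
        using E[of "\<kappa> e0" 0 "E (\<kappa> e0)"] \<kappa>[OF \<open>e0 \<in> J\<close>] shift[OF \<open>e0 \<in> J\<close>] by (simp add: E_def keys_expo)
      ultimately have "\<kappa> e = \<kappa> e0"
        using \<kappa>(1)[OF that] \<kappa>(1)[OF \<open>e0 \<in> J\<close>] by (simp add: expo_vec_0)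
      then have "expo_vec m e = expo_vec m e0"
        using \<kappa>(2)[OF that] \<kappa>(2)[OF \<open>e0 \<in> J\<close>] by simp
      moreover have "Poly_Mapping.keys e \<subseteq> {..<m}" "Poly_Mapping.keys e0 \<subseteq> {..<m}"
        using that e0 Q(1) by (auto simp: J_def fpoly_over_def)
      ultimately show "e = e0"
        by (intro expo_vec_inject)
    qed simp
    then have "Poly_Mapping.lookup Q' (E (\<kappa> e0)) = (\<Sum>e\<in>J. Poly_Mapping.lookup Q e when e = e0)"
      unfolding Q'_def lookup_sum lookup_single by (intro sum.cong) auto
    also have "\<dots> = Poly_Mapping.lookup Q e0"
      using \<open>e0 \<in> J\<close> fin(1) by (simp add: when_def)
    finally show ?thesis
      using e0 by (auto simp: in_keys_iff)
  qed
  moreover have "P' \<noteq> 0"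
    using calculation F(2) by (metis mult_eq_0_iff)
  ultimately show thesis
    using that P'_over Q'_over by blast
qed

text \<open>\<open>y k\<close> has the value \<open>d k * g' $ k\<close> by
  \<open>column_weight\<close>, nonzero coefficients from \<open>Nz\<close> have value 0, and a sum
  takes the maximum of the values of its terms.\<close>

lemma val_yeval:
  assumes g': "g' \<in> carrier_vec m" and P: "P \<in> fpoly_over n (Nz n r)" "P \<noteq> 0"
  shows "val (\<Lambda> *\<^sub>v g') (yeval P) (max_weight n (diag_zero n m d *\<^sub>v g') P)"
proof -
  let ?w = "\<Lambda> *\<^sub>v g'" and ?h = "diag_zero n m d *\<^sub>v g'"
  have "val ?w (y k) (?h $ k)" if "k < n" for k
    using val_laurent_monomial[of ?w "col B k"] column_weight[OF that g'] that B_carrier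
    by (simp add: yhat_def diag_zero_mult_vec[OF n_le_m g'])
  then have "val ?w (expo_val n y e) (exp_weight n ?h e)" for e
    unfolding expo_val_def exp_weight_def by (intro val_prod val_power) auto
  then have "val ?w (Poly_Mapping.lookup P e * expo_val n y e) (0 + exp_weight n ?h e)"
    if "e \<in> Poly_Mapping.keys P" for e
    using that fpoly_over_lookup[OF subsemiring_Nz P(1)]
    by (intro val_mult val_const) (auto simp: in_keys_iff)
  then have "val ?w (\<Sum>e\<in>Poly_Mapping.keys P. Poly_Mapping.lookup P e * expo_val n y e)
      (Max (exp_weight n ?h ` Poly_Mapping.keys P))"
    using P(2) by (intro val_sum) auto
  then show ?thesis
    unfolding max_weight_def using fpoly_eval_superset[of "Poly_Mapping.keys P" P n y] by simp
qed

text \<open>\<open>F\<close> may have coefficients outside \<open>Nz\<close>, so its value is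
  computed from a numerator and a denominator to which \<open>val_yeval\<close> applies; uniqueness
  of values then identifies \<open>c\<close>.\<close>

lemma val_pointed:
  assumes F: "F \<in> fpoly_over n (Qz n r)" "F \<noteq> 0"
    and g: "g \<in> carrier_vec m" and g': "g' \<in> carrier_vec m"
    and val: "val (\<Lambda> *\<^sub>v g') (xmon g * yeval F) c"
  shows "c = g \<bullet> (\<Lambda> *\<^sub>v g') + F_bracket n r (Fraction_Field.Fract F 1) (diag_zero n m d *\<^sub>v g')"
proof -
  let ?w = "\<Lambda> *\<^sub>v g'" and ?h = "diag_zero n m d *\<^sub>v g'"
  obtain P Q where PQ: "P \<in> fpoly_over n (Nz n r)" "Q \<in> fpoly_over n (Nz n r)" "P \<noteq> 0" "Q \<noteq> 0" "F * Q = P"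
    using subtraction_free_quotient[OF F g val] .
  have "yeval Q \<noteq> 0"
    using val_nonzero[OF val_yeval[OF g' PQ(2,4)]] .
  moreover have "yeval F * yeval Q = yeval P"
    using PQ(5) by (simp flip: fpoly_eval_mult)
  ultimately have *: "yeval F = yeval P / yeval Q"
    by (simp add: field_simps)
  have "val ?w (xmon g * yeval F)
      ((\<Sum>i<m. g $ i * ?w $ i) + (max_weight n ?h P - max_weight n ?h Q))"
    unfolding * by (intro val_mult val_divide val_laurent_monomial val_yeval g' PQ)
  then have "c = (\<Sum>i<m. g $ i * ?w $ i) + (max_weight n ?h P - max_weight n ?h Q)"
    using val_unique[OF val] by blast
  moreover have "g \<bullet> ?w = (\<Sum>i<m. g $ i * ?w $ i)"
    using L_carrier g' by (intro scalar_prod_lessThan) auto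
  moreover have "Fraction_Field.Fract F 1 = Fraction_Field.Fract P Q"
    using PQ by (simp add: Fraction_Field.eq_fract)
  ultimately show ?thesis
    using F_bracket_Fract[OF PQ(1-4)] by simp
qed

end

subsection \<open>Mutation of weights\<close>

text \<open>A linear function on an interval is maximal at an end point. Hence the inner terms of
  the exchange sum leave no trace in its tropicalization.\<close>

lemma Max_int_multiples: "Max ((\<lambda>s. int s * c) ` {0..k}) = max 0 (int k * c)"
proof (rule Max_eqI)
  show "max 0 (int k * c) \<in> (\<lambda>s. int s * c) ` {0..k}"
    by (cases "c \<ge> 0") (auto simp: max_def image_iff mult_nonneg_nonpos)
  fix a assume "a \<in> (\<lambda>s. int s * c) ` {0..k}"
  then obtain s where s: "s \<le> k" "a = int s * c" by auto
  show "a \<le> max 0 (int k * c)"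
  proof (cases "c \<ge> 0")
    case True
    then show ?thesis
      using s by (simp add: max.coboundedI2 mult_right_mono)
  next
    case False
    then show ?thesis
      using s by (simp add: max.coboundedI1 mult_nonneg_nonpos)
  qed
qed simp

lemma posp_mult: "0 \<le> a \<Longrightarrow> posp (a * b) = a * posp b"
  by (cases "b \<ge> 0") (simp_all add: posp_def max.absorb1 max.absorb2 mult_nonneg_nonpos)

lemma zcoef_in_Nz: "k < n \<Longrightarrow> s \<le> r k \<Longrightarrow> zcoef r k s \<in> Nz n r"
proof -
  assume *: "k < n" "s \<le> r k"
  show ?thesis
  proof (cases "s = 0 \<or> s = r k")
    case True
    then show ?thesis
      by (auto simp: zcoef_def intro: subsemiring_1 subsemiring_Nz)
  next
    case False
    then have "zcoef r k s \<in> zvars n r"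
      using * unfolding zvars_def by (intro CollectI exI[of _ k] exI[of _ s]) auto
    then show ?thesis
      unfolding Nz_def by (rule subsemiring_gen.intros(1))
  qed
qed

lemma gen_nonzero: "gen v \<noteq> 0"
proof -
  have "Poly_Mapping.single (Poly_Mapping.single v (1::nat)) (1::int) \<noteq> 0"
    by (metis lookup_single_eq lookup_zero zero_neq_one)
  then show ?thesis
    by (simp add: gen_def Fraction_Field.Zero_fract_def Fraction_Field.eq_fract)
qed

lemma zcoef_nonzero: "zcoef r k s \<noteq> 0"
  by (simp add: zcoef_def gen_nonzero)

text \<open>The product \<open>x\<^sub>k\<^sub>;\<^sub>t x\<^sub>k\<^sub>;\<^sub>t\<^sub>'\<close>, which does not involve \<open>x\<^sub>k\<^sub>;\<^sub>t\<close>.\<close>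

definition exchange_value ::
  "int \<Rightarrow> nat \<Rightarrow> (nat \<Rightarrow> nat) \<Rightarrow> nat \<Rightarrow> (nat \<Rightarrow> ratfun) \<Rightarrow> int mat \<Rightarrow> ratfun" where
  "exchange_value \<epsilon> m r k x B =
     (\<Prod>j<m. x j powi posp (- \<epsilon> * B $$ (j, k))) ^ r k *
     (\<Sum>s = 0..r k. zcoef r k s * yhat m x B k powi (\<epsilon> * int s))"

text \<open>The tropicalization of \<open>exchange_value\<close>: the maximum is between the end
  terms \<open>s = 0\<close> and \<open>s = r k\<close> of the sum.\<close>

definition exchange_weight ::
  "int \<Rightarrow> nat \<Rightarrow> (nat \<Rightarrow> nat) \<Rightarrow> nat \<Rightarrow> int vec \<Rightarrow> int mat \<Rightarrow> int" where
  "exchange_weight \<epsilon> m r k w B =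
     int (r k) * (\<Sum>j<m. posp (- \<epsilon> * B $$ (j, k)) * w $ j) +
     max 0 (int (r k) * (\<epsilon> * (\<Sum>j<m. B $$ (j, k) * w $ j)))"

text \<open>With zero diagonal entry, \<open>x k\<close> has exponent 0 throughout. The exchange
  value can therefore be read in the adjacent cluster, which differs at \<open>k\<close>
  alone.\<close>

lemma exchange_value_cong:
  assumes "B \<in> carrier_mat m n" "k < n" "B $$ (k, k) = 0" "\<And>j. j < m \<Longrightarrow> j \<noteq> k \<Longrightarrow> x j = x' j"
  shows "exchange_value \<epsilon> m r k x B = exchange_value \<epsilon> m r k x' B"
proof -
  have "(\<Prod>j<m. x j powi posp (- \<epsilon> * B $$ (j, k))) = (\<Prod>j<m. x' j powi posp (- \<epsilon> * B $$ (j, k)))"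
    using assms(3,4) by (intro prod.cong refl) (metis lessThan_iff mult_zero_right posp_def max.idem power_int_0_right)
  moreover have "yhat m x B k = yhat m x' B k"
    unfolding yhat_def laurent_monomial_def
  proof (intro prod.cong refl)
    fix j assume j: "j \<in> {..<m}"
    then have "col B k $ j = B $$ (j, k)"
      using assms(1,2) by simp
    then show "x j powi col B k $ j = x' j powi col B k $ j"
      using assms(3) assms(4)[of j] j by (cases "j = k") auto
  qed
  ultimately show ?thesis
    by (simp add: exchange_value_def)
qed

lemma exchange_weight_cong:
  assumes "B $$ (k, k) = 0" "\<And>j. j < m \<Longrightarrow> j \<noteq> k \<Longrightarrow> w $ j = w' $ j"
  shows "exchange_weight \<epsilon> m r k w B = exchange_weight \<epsilon> m r k w' B"
proof -
  have "(\<Sum>j<m. posp (- \<epsilon> * B $$ (j, k)) * w $ j) = (\<Sum>j<m. posp (- \<epsilon> * B $$ (j, k)) * w' $ j)"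
    using assms by (intro sum.cong refl) (metis lessThan_iff mult_zero_left mult_zero_right posp_def max.idem)
  moreover have "(\<Sum>j<m. B $$ (j, k) * w $ j) = (\<Sum>j<m. B $$ (j, k) * w' $ j)"
    using assms by (intro sum.cong refl) (metis lessThan_iff mult_zero_left)
  ultimately show ?thesis
    by (simp add: exchange_weight_def)
qed

lemma (in independent_tuple) val_exchange_value:
  assumes "B \<in> carrier_mat m n" "k < n"
  shows "val w (exchange_value \<epsilon> m r k x B) (exchange_weight \<epsilon> m r k w B)"
proof -
  let ?Y = "\<Sum>j<m. B $$ (j, k) * w $ j"
  have "val w (yhat m x B k) (\<Sum>j<m. col B k $ j * w $ j)"
    unfolding yhat_def by (rule val_laurent_monomial)
  also have "(\<Sum>j<m. col B k $ j * w $ j) = ?Y"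
    using assms by (intro sum.cong) auto
  finally have "val w (yhat m x B k) ?Y" .
  then have "val w (zcoef r k s * yhat m x B k powi (\<epsilon> * int s)) (0 + (\<epsilon> * int s) * ?Y)"
    if "s \<in> {0..r k}" for s
    using that assms(2) by (intro val_mult val_const val_power_int zcoef_in_Nz zcoef_nonzero) auto
  then have "val w (\<Sum>s = 0..r k. zcoef r k s * yhat m x B k powi (\<epsilon> * int s))
      (Max ((\<lambda>s. 0 + (\<epsilon> * int s) * ?Y) ` {0..r k}))"
    by (intro val_sum) auto
  also have "(\<lambda>s. 0 + (\<epsilon> * int s) * ?Y) = (\<lambda>s. int s * (\<epsilon> * ?Y))"
    by (simp add: fun_eq_iff)
  finally have "val w (\<Sum>s = 0..r k. zcoef r k s * yhat m x B k powi (\<epsilon> * int s))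
      (max 0 (int (r k) * (\<epsilon> * ?Y)))"
    unfolding Max_int_multiples .
  moreover have "val w ((\<Prod>j<m. x j powi posp (- \<epsilon> * B $$ (j, k))) ^ r k)
      (int (r k) * (\<Sum>j<m. posp (- \<epsilon> * B $$ (j, k)) * w $ j))"
    by (intro val_power val_prod val_power_int val_var) auto
  ultimately show ?thesis
    unfolding exchange_value_def exchange_weight_def by (intro val_mult)
qed

text \<open>With \<open>E\<close> the mutation matrix and \<open>b\<close> the \<open>k\<close>-th column of \<open>B\<close>, the tropical mutation rule says
  \<open>E g' = g + r\<^sub>k [\<epsilon> g\<^sub>k]\<^sub>+ b\<close>, and \<open>\<Lambda> b = - d\<^sub>k e\<^sub>k\<close>.\<close>

lemma (in compatible_seed) mutation_weights:
  assumes \<epsilon>: "\<epsilon> \<in> {1, -1}" and k: "k < n" and Bkk: "B $$ (k, k) = 0"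
    and skew: "transpose_mat \<Lambda> = - \<Lambda>"
    and g: "g \<in> carrier_vec m" and g': "g' \<in> carrier_vec m"
    and g'k: "g' $ k = - g $ k"
    and g'i: "\<And>i. i < m \<Longrightarrow> i \<noteq> k \<Longrightarrow> g' $ i = g $ i + posp (int (r k) * - B $$ (i, k)) * g $ k
        - int (r k) * - B $$ (i, k) * posp (g $ k)"
    and \<Lambda>': "\<Lambda>' = transpose_mat (mutation_E \<epsilon> m r k B) * \<Lambda> * mutation_E \<epsilon> m r k B"
    and i: "i < m"
  shows "(\<Lambda>' *\<^sub>v g') $ i =
    (if i = k then - (\<Lambda> *\<^sub>v g) $ k + exchange_weight \<epsilon> m r k (\<Lambda> *\<^sub>v g) B else (\<Lambda> *\<^sub>v g) $ i)"
proof -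
  let ?E = "mutation_E \<epsilon> m r k B"
  define w where "w = \<Lambda> *\<^sub>v g"
  define s where "s = int (r k) * posp (\<epsilon> * g $ k)"
  have km: "k < m"
    using k n_le_m by simp
  have E: "?E \<in> carrier_mat m m"
    by (simp add: mutation_E_def)
  have Eij: "?E $$ (i, j) = (if j = k then (if i = k then -1 else posp (- \<epsilon> * B $$ (i, k) * int (r k)))
      else if i = j then 1 else 0)" if "i < m" "j < m" for i j
    using that by (simp add: mutation_E_def)
  have Eg: "(?E *\<^sub>v g') $ i = g $ i + s * B $$ (i, k)" if i: "i < m" for i
  proof -
    have "(?E *\<^sub>v g') $ i = (\<Sum>j<m. ?E $$ (i, j) * g' $ j)"
      using E g' i by (rule mat_vec_index)
    also have "\<dots> = ?E $$ (i, k) * g' $ k + (\<Sum>j\<in>{..<m} - {k}. ?E $$ (i, j) * g' $ j)"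
      using km by (intro sum.remove) auto
    also have "(\<Sum>j\<in>{..<m} - {k}. ?E $$ (i, j) * g' $ j) = (\<Sum>j\<in>{..<m} - {k}. if j = i then g' $ i else 0)"
      using i by (intro sum.cong) (auto simp: Eij)
    also have "\<dots> = (if i = k then 0 else g' $ i)"
      using i by simp
    finally have *: "(?E *\<^sub>v g') $ i = ?E $$ (i, k) * g' $ k + (if i = k then 0 else g' $ i)" .
    show ?thesis
    proof (cases "i = k")
      case True
      then show ?thesis
        using * Eij[OF i km] g'k Bkk by simp
    next
      case False
      let ?a = "int (r k) * B $$ (i, k)"
      have "(?E *\<^sub>v g') $ i = - posp (- \<epsilon> * ?a) * g $ k + (g $ i + posp (- ?a) * g $ k + ?a * posp (g $ k))"
        using * Eij[OF i km] g'k g'i[OF i False] False by (simp add: mult_ac)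
      also have "\<dots> = g $ i + ?a * posp (\<epsilon> * g $ k)"
      \<comment> \<open>For \<epsilon> = 1 the two terms with \<open>posp (- ?a)\<close> cancel. For
        \<epsilon> = -1 the identity \<open>posp a - posp (- a) = a\<close> moves the difference
        into \<open>posp (- g $ k)\<close>.\<close>
      proof (cases "\<epsilon> = 1")
        case False
        then have "\<epsilon> = -1"
          using \<epsilon> by simp
        then have *: "posp (- \<epsilon> * ?a) = posp ?a" "posp (- ?a) = posp ?a - ?a"
          "posp (\<epsilon> * g $ k) = posp (g $ k) - g $ k"
          by (auto simp: posp_def)
        show ?thesis
          unfolding * by (simp add: algebra_simps)
      qed simp
      finally show ?thesis
        by (simp add: s_def mult_ac)
    qed
  qed
  \<comment> \<open>Compatibility concerns the rows of \<open>transpose_mat B * \<Lambda>\<close>;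
    testing it on unit vectors and using skew-symmetry gives \<open>\<Lambda>\<close> times a column
    of \<open>B\<close>.\<close>
  have L_col: "(\<Sum>j<m. \<Lambda> $$ (i, j) * B $$ (j, k)) = (if i = k then - d k else 0)" if i: "i < m" for i
  proof -
    have "(\<Lambda> *\<^sub>v unit_vec m i) $ j = - \<Lambda> $$ (i, j)" if j: "j < m" for j
    proof -
      have "(\<Lambda> *\<^sub>v unit_vec m i) $ j = (\<Sum>l<m. \<Lambda> $$ (j, l) * unit_vec m i $ l)"
        using L_carrier j by (intro mat_vec_index) auto
      also have "\<dots> = (\<Sum>l<m. if l = i then \<Lambda> $$ (j, i) else 0)"
        using i by (intro sum.cong) auto
      also have "\<dots> = transpose_mat \<Lambda> $$ (i, j)"
        using i j L_carrier by simp
      finally show ?thesis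
        using i j L_carrier by (simp add: skew)
    qed
    then have "(\<Sum>j<m. B $$ (j, k) * (\<Lambda> *\<^sub>v unit_vec m i) $ j) = - (\<Sum>j<m. \<Lambda> $$ (i, j) * B $$ (j, k))"
      unfolding sum_negf[symmetric] by (intro sum.cong) auto
    then show ?thesis
      using column_weight[OF k, of "unit_vec m i"] i km by (simp split: if_splits)
  qed
  define v where "v = \<Lambda> *\<^sub>v (?E *\<^sub>v g')"
  have v_carrier: "v \<in> carrier_vec m"
    unfolding v_def using L_carrier E g' by (intro mult_mat_vec_carrier)
  have v: "v $ i = w $ i - (if i = k then s * d k else 0)" if i: "i < m" for i
  proof -
    have "v $ i = (\<Sum>j<m. \<Lambda> $$ (i, j) * (?E *\<^sub>v g') $ j)"
      unfolding v_def using L_carrier E g' i by (intro mat_vec_index mult_mat_vec_carrier)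
    also have "\<dots> = (\<Sum>j<m. \<Lambda> $$ (i, j) * g $ j + s * (\<Lambda> $$ (i, j) * B $$ (j, k)))"
      by (intro sum.cong) (auto simp: Eg algebra_simps)
    also have "\<dots> = (\<Sum>j<m. \<Lambda> $$ (i, j) * g $ j) + s * (\<Sum>j<m. \<Lambda> $$ (i, j) * B $$ (j, k))"
      by (simp add: sum.distrib sum_distrib_left)
    also have "(\<Sum>j<m. \<Lambda> $$ (i, j) * g $ j) = w $ i"
      unfolding w_def using L_carrier g i by (rule mat_vec_index[symmetric])
    finally show ?thesis
      by (simp add: L_col[OF i])
  qed
  have "\<Lambda>' *\<^sub>v g' = transpose_mat ?E *\<^sub>v v"
    unfolding \<Lambda>' v_def using E L_carrier g'
    by (simp add: assoc_mult_mat_vec[of _ m m _ m])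
  then have "(\<Lambda>' *\<^sub>v g') $ i = (\<Sum>j<m. transpose_mat ?E $$ (i, j) * v $ j)"
    using E v_carrier i by (simp add: mat_vec_index[of _ m m])
  also have "\<dots> = (\<Sum>j<m. ?E $$ (j, i) * v $ j)"
    using E i by (intro sum.cong) auto
  finally have *: "(\<Lambda>' *\<^sub>v g') $ i = (\<Sum>j<m. ?E $$ (j, i) * v $ j)" .
  show ?thesis
  proof (cases "i = k")
    case False
    then have "(\<Sum>j<m. ?E $$ (j, i) * v $ j) = (\<Sum>j<m. if j = i then v $ i else 0)"
      using i by (intro sum.cong) (auto simp: Eij)
    then show ?thesis
      using * i False v[OF i] by (simp add: w_def)
  next
    case True
    have "(\<Sum>j<m. ?E $$ (j, k) * v $ j) = ?E $$ (k, k) * v $ k + (\<Sum>j\<in>{..<m} - {k}. ?E $$ (j, k) * v $ j)"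
      using km by (intro sum.remove) auto
    also have "(\<Sum>j\<in>{..<m} - {k}. ?E $$ (j, k) * v $ j) =
        (\<Sum>j\<in>{..<m} - {k}. int (r k) * (posp (- \<epsilon> * B $$ (j, k)) * w $ j))"
    proof (intro sum.cong refl)
      fix j assume "j \<in> {..<m} - {k}"
      then show "?E $$ (j, k) * v $ j = int (r k) * (posp (- \<epsilon> * B $$ (j, k)) * w $ j)"
        using posp_mult[of "int (r k)" "- \<epsilon> * B $$ (j, k)"] km
        by (simp add: Eij v mult_ac)
    qed
    also have "\<dots> = (\<Sum>j<m. int (r k) * (posp (- \<epsilon> * B $$ (j, k)) * w $ j))"
      using Bkk by (intro sum.mono_neutral_left) (auto simp: posp_def)
    also have "\<dots> = int (r k) * (\<Sum>j<m. posp (- \<epsilon> * B $$ (j, k)) * w $ j)"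
      by (simp add: sum_distrib_left)
    also have "?E $$ (k, k) * v $ k = - w $ k + s * d k"
      using Eij[OF km km] v[OF km] by simp
    \<comment> \<open>Since \<open>d k * g $ k\<close> is the weight of \<open>yhat\<close> at
      \<open>k\<close>, the correction caused by mutating \<open>g\<close> is exactly the maximum in
      the tropicalized exchange sum.\<close>
    also have "s * d k = max 0 (int (r k) * (\<epsilon> * (\<Sum>j<m. B $$ (j, k) * w $ j)))"
    proof -
      have "(\<Sum>j<m. B $$ (j, k) * w $ j) = d k * g $ k"
        unfolding w_def using k g by (rule column_weight)
      then have "max 0 (int (r k) * (\<epsilon> * (\<Sum>j<m. B $$ (j, k) * w $ j))) =
          posp ((int (r k) * d k) * (\<epsilon> * g $ k))"
        by (simp add: posp_def mult_ac max.commute)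
      also have "\<dots> = int (r k) * d k * posp (\<epsilon> * g $ k)"
        using d_pos[OF k] by (intro posp_mult) simp
      finally show ?thesis
        by (simp add: s_def mult_ac)
    qed
    finally show ?thesis
      using * True by (simp add: exchange_weight_def w_def)
  qed
qed

subsection \<open>Independence of the vertex\<close>

locale lp_triple =
  fixes S :: "'v cluster_pattern"
    and Y \<Lambda> :: "'v \<Rightarrow> int mat"
    and d :: "nat \<Rightarrow> int"
    and \<epsilon> :: int
  assumes eps: "\<epsilon> \<in> {1, -1}"
    and triple: "langland_poisson_triple \<epsilon> S Y \<Lambda> d"
begin

abbreviation n :: nat where "n \<equiv> nmut S"
abbreviation m :: nat where "m \<equiv> nvar S"
abbreviation r :: "nat \<Rightarrow> nat" where "r \<equiv> rdeg S"
abbreviation x :: "'v \<Rightarrow> nat \<Rightarrow> ratfun" where "x \<equiv> cvar S"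
abbreviation B :: "'v \<Rightarrow> int mat" where "B \<equiv> exmat S"

abbreviation valt :: "'v \<Rightarrow> int vec \<Rightarrow> ratfun \<Rightarrow> int \<Rightarrow> bool" where
  "valt t \<equiv> tropical_value n r m (x t)"

lemma pattern: "rz_cluster_pattern \<epsilon> S"
  and dual: "langlands_dual S Y"
  and poisson: "poisson_compatible \<epsilon> S \<Lambda> d"
  using triple by (simp_all add: langland_poisson_triple_def)

lemma seed:
  assumes "t \<in> verts S"
  shows "is_seed m n r (x t) (B t)"
  using pattern assms by (simp add: rz_cluster_pattern_def)

lemma n_le_m: "n \<le> m"
  using pattern by (simp add: rz_cluster_pattern_def)

lemma compatible_seed:
  assumes "t \<in> verts S"
  shows "compatible_seed n r m (x t) (B t) (\<Lambda> t) d"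
  using seed[OF assms] n_le_m poisson assms
  unfolding is_seed_def poisson_compatible_def by unfold_locales auto

lemma diagonal_zero:
  assumes "t \<in> verts S" "k < n"
  shows "B t $$ (k, k) = 0"
proof -
  obtain s :: "nat \<Rightarrow> int" where "s k > 0" "s k * B t $$ (k, k) = - (s k * B t $$ (k, k))"
    using seed[OF assms(1)] assms(2) unfolding is_seed_def skew_symmetrizable_def by blast
  then show ?thesis by simp
qed

lemma edgeD:
  assumes "edge S k t t'"
  shows "k < n" "t \<in> verts S" "t' \<in> verts S"
    and "\<And>i. i < m \<Longrightarrow> i \<noteq> k \<Longrightarrow> x t' i = x t i"
    and "x t' k = mutate_var \<epsilon> m r k (x t) (B t)"
    and "\<Lambda> t' = transpose_mat (mutation_E \<epsilon> m r k (B t)) * \<Lambda> t * mutation_E \<epsilon> m r k (B t)"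
proof -
  have "labelled_regular_tree n (verts S) (edge S)"
    using pattern by (simp add: rz_cluster_pattern_def)
  then show "k < n" "t \<in> verts S" "t' \<in> verts S"
    using assms unfolding labelled_regular_tree_def by blast+
  show "x t' i = x t i" if "i < m" "i \<noteq> k" for i
    using pattern assms that unfolding rz_cluster_pattern_def by blast
  show "x t' k = mutate_var \<epsilon> m r k (x t) (B t)"
    using pattern assms unfolding rz_cluster_pattern_def by blast
  show "\<Lambda> t' = transpose_mat (mutation_E \<epsilon> m r k (B t)) * \<Lambda> t * mutation_E \<epsilon> m r k (B t)"
    using poisson assms unfolding poisson_compatible_def Let_def by blast
qed

section \<open>Degree, F-polynomial and pairing at a vertex\<close>

lemma pointed_with_deg:
  assumes t: "t \<in> verts S" and u: "pointed_at S t u"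
  shows "pointed_with S t u (deg S t u)"
  unfolding deg_def
proof (rule theI')
  interpret compatible_seed n r m "x t" "B t" "\<Lambda> t" d
    by (rule compatible_seed[OF t])
  show "\<exists>!g. pointed_with S t u g"
  proof (rule ex_ex1I)
    show "\<exists>g. pointed_with S t u g"
      using u by (simp add: pointed_at_def)
    fix g g' assume "pointed_with S t u g" "pointed_with S t u g'"
    then obtain b b' where b: "finite {h. b h \<noteq> 0}" "{h. b h \<noteq> 0} \<subseteq> carrier_vec m" "range b \<subseteq> Zz n r"
        "u = (\<Sum>h | b h \<noteq> 0. b h * xmon h)"
        "{h. b h \<noteq> 0 \<and> (\<forall>h'. b h' \<noteq> 0 \<and> dominance_le (B t) h h' \<longrightarrow> h' = h)} = {g}"
      and b': "finite {h. b' h \<noteq> 0}" "{h. b' h \<noteq> 0} \<subseteq> carrier_vec m" "range b' \<subseteq> Zz n r"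
        "u = (\<Sum>h | b' h \<noteq> 0. b' h * xmon h)"
        "{h. b' h \<noteq> 0 \<and> (\<forall>h'. b' h' \<noteq> 0 \<and> dominance_le (B t) h h' \<longrightarrow> h' = h)} = {g'}"
      unfolding pointed_with_def by blast
    have "b = b'"
      using pointed_coeffs_unique[OF b(1-3) b'(1-3)] b(4) b'(4) by simp
    then have "{g} = {g'}"
      using b(5) b'(5) by simp
    then show "g = g'" by simp
  qed
qed

lemma F_poly_pointed:
  assumes t: "t \<in> verts S" and u: "pointed_at S t u"
  shows "F_poly S t u \<in> fpoly_over n (Zz n r)" "Poly_Mapping.lookup (F_poly S t u) 0 = 1"
    and "u = laurent_monomial m (x t) (deg S t u) * fpoly_eval n (yhat m (x t) (B t)) (F_poly S t u)"
    and "deg S t u \<in> carrier_vec m"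
proof -
  interpret compatible_seed n r m "x t" "B t" "\<Lambda> t" d
    by (rule compatible_seed[OF t])
  obtain b where b: "finite {h. b h \<noteq> 0}" "{h. b h \<noteq> 0} \<subseteq> carrier_vec m" "range b \<subseteq> Zz n r"
      "b (deg S t u) = 1"
      "{h. b h \<noteq> 0 \<and> (\<forall>h'. b h' \<noteq> 0 \<and> dominance_le (B t) h h' \<longrightarrow> h' = h)} = {deg S t u}"
    and u_eq: "u = (\<Sum>h | b h \<noteq> 0. b h * xmon h)"
    using pointed_with_deg[OF t u] unfolding pointed_with_def by blast
  show "deg S t u \<in> carrier_vec m"
    using b(2,4) by auto
  obtain F where F: "F \<in> fpoly_over n (Zz n r)" "Poly_Mapping.lookup F 0 = 1" "u = xmon (deg S t u) * yeval F"
    using pointed_polynomial[OF b] unfolding u_eq[symmetric] by blast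
  let ?P = "\<lambda>F. F \<in> fpoly_over n (Zz n r) \<and> Poly_Mapping.lookup F 0 = 1 \<and> u = xmon (deg S t u) * yeval F"
  have "\<exists>!F. ?P F"
  proof (rule ex1I[of _ F])
    fix G assume G: "?P G"
    then show "G = F"
      using F y_polynomial_unique[of G F "deg S t u"] by metis
  qed (use F in blast)
  from theI'[OF this] have "?P (F_poly S t u)"
    unfolding F_poly_def .
  then show "F_poly S t u \<in> fpoly_over n (Zz n r)" "Poly_Mapping.lookup (F_poly S t u) 0 = 1"
    "u = laurent_monomial m (x t) (deg S t u) * fpoly_eval n (yhat m (x t) (B t)) (F_poly S t u)"
    by blast+
qed

lemma pairing_eq_val:
  assumes t: "t \<in> verts S" and u: "pointed_at S t u" and u': "pointed_at S t u'"
    and val: "valt t (\<Lambda> t *\<^sub>v deg S t u') u c"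
  shows "pairing S \<Lambda> d t u u' = c"
proof -
  interpret compatible_seed n r m "x t" "B t" "\<Lambda> t" d
    by (rule compatible_seed[OF t])
  note F = F_poly_pointed[OF t u]
  have "F_poly S t u \<in> fpoly_over n (Qz n r)"
    using F(1) fpoly_over_mono[OF Zz_subset_Qz] by blast
  moreover have "F_poly S t u \<noteq> 0"
    using F(2) by auto
  moreover have "val (\<Lambda> t *\<^sub>v deg S t u') (xmon (deg S t u) * yeval (F_poly S t u)) c"
    using val F(3) by simp
  ultimately show ?thesis
    unfolding pairing_def using val_pointed[OF _ _ F(4) F_poly_pointed(4)[OF t u']] by simp
qed

text \<open>The one variable that changes is \<open>x t k\<close>. At \<open>t'\<close> it is the
  exchange value divided by \<open>x t' k\<close>, whose weight is the exchange weight minus the old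
  weight; the exchange weight cancels and the old weight remains.\<close>

lemma edge_val_generator:
  assumes edge: "edge S k t t'" and g: "tropical_point S Y g"
    and a: "a \<in> x t ` {..<m} \<union> zvars n r"
  shows "\<exists>c. valt t (\<Lambda> t *\<^sub>v g t) a c \<and> valt t' (\<Lambda> t' *\<^sub>v g t') a c"
proof -
  note e = edgeD[OF edge]
  interpret T: compatible_seed n r m "x t" "B t" "\<Lambda> t" d
    by (rule compatible_seed[OF e(2)])
  interpret T': compatible_seed n r m "x t'" "B t'" "\<Lambda> t'" d
    by (rule compatible_seed[OF e(3)])
  let ?w = "\<Lambda> t *\<^sub>v g t" and ?w' = "\<Lambda> t' *\<^sub>v g t'"
  have km: "k < m"
    using e(1) n_le_m by simp
  have Bkk: "B t $$ (k, k) = 0"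
    by (rule diagonal_zero[OF e(2,1)])
  have w': "?w' $ i = (if i = k then - ?w $ k + exchange_weight \<epsilon> m r k ?w (B t) else ?w $ i)" if i: "i < m" for i
  proof (rule T.mutation_weights[OF eps e(1) Bkk _ _ _ _ _ e(6) i])
    show "transpose_mat (\<Lambda> t) = - \<Lambda> t"
      using poisson e(2) by (simp add: poisson_compatible_def)
    show "g t \<in> carrier_vec m" "g t' \<in> carrier_vec m" "g t' $ k = - g t $ k"
      using g e(2,3) edge by (auto simp: tropical_point_def)
    fix i assume i: "i < m" "i \<noteq> k"
    have "Y t $$ (k, i) = - B t $$ (i, k)"
      using dual e(1,2) i(1) T.B_carrier by (simp add: langlands_dual_def)
    then show "g t' $ i = g t $ i + posp (int (r k) * - B t $$ (i, k)) * g t $ k -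
        int (r k) * - B t $$ (i, k) * posp (g t $ k)"
      using g edge i unfolding tropical_point_def by metis
  qed
  consider i where "i < m" "i \<noteq> k" "a = x t i" | "a = x t k" | "a \<in> zvars n r"
    using a by blast
  then show ?thesis
  proof cases
    case 1
    then have "valt t ?w a (?w $ i)" "valt t' ?w' a (?w' $ i)"
      using T.val_var[of i ?w] T'.val_var[of i ?w'] e(4) by auto
    then show ?thesis
      using w'[OF 1(1)] 1(2) by auto
  next
    case 2
    let ?v = "exchange_value \<epsilon> m r k (x t) (B t)"
    have "x t' k = inverse (x t k) * ?v"
      by (simp add: e(5) mutate_var_def exchange_value_def mult_ac)
    then have "a = ?v / x t' k"
      using T.x_nonzero[OF km] T'.x_nonzero[OF km] 2 by (simp add: field_simps)
    moreover have "?v = exchange_value \<epsilon> m r k (x t') (B t)"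
      by (rule exchange_value_cong[OF T.B_carrier e(1) Bkk]) (simp add: e(4))
    moreover have "exchange_weight \<epsilon> m r k ?w (B t) = exchange_weight \<epsilon> m r k ?w' (B t)"
      by (rule exchange_weight_cong[OF Bkk]) (simp add: w')
    ultimately have "valt t' ?w' a (exchange_weight \<epsilon> m r k ?w (B t) - ?w' $ k)"
      using T'.val_divide[OF T'.val_exchange_value[OF T.B_carrier e(1)] T'.val_var[OF km]] by simp
    then have "valt t' ?w' a (?w $ k)"
      by (simp add: w'[OF km])
    then show ?thesis
      using T.val_var[OF km] 2 by blast
  next
    case 3
    then have "a \<in> Nz n r"
      unfolding Nz_def by (rule subsemiring_gen.intros(1))
    moreover have "a \<noteq> 0"
      using 3 zcoef_nonzero unfolding zvars_def by auto
    ultimately show ?thesis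
      using T.val_const T'.val_const by blast
  qed
qed

text \<open>One expression, in the variables at \<open>t\<close>, is valued in both clusters. Sums,
  products and quotients act on values in the same way at both, so agreement spreads from the
  generators.\<close>

lemma edge_val:
  assumes edge: "edge S k t t'" and g: "tropical_point S Y g"
    and a: "a \<in> subtraction_free (x t ` {..<m} \<union> zvars n r)"
  shows "\<exists>c. valt t (\<Lambda> t *\<^sub>v g t) a c \<and> valt t' (\<Lambda> t' *\<^sub>v g t') a c"
proof -
  interpret T: compatible_seed n r m "x t" "B t" "\<Lambda> t" d
    by (rule compatible_seed[OF edgeD(2)[OF edge]])
  interpret T': compatible_seed n r m "x t'" "B t'" "\<Lambda> t'" d
    by (rule compatible_seed[OF edgeD(3)[OF edge]])
  show ?thesis
    using a
  proof induction
    case (1 a)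
    then show ?case
      by (rule edge_val_generator[OF edge g])
  next
    case 2
    then show ?case
      using T.val_one T'.val_one by blast
  next
    case (3 a b)
    then show ?case
      using T.val_add T'.val_add by blast
  next
    case (4 a b)
    then show ?case
      using T.val_mult T'.val_mult by blast
  next
    case (5 a b)
    then show ?case
      using T.val_divide T'.val_divide by blast
  qed
qed

text \<open>The two elements play different roles: \<open>u'\<close> supplies the weights through
  its tropical point, and \<open>u\<close> supplies the expression to be valued.\<close>

lemma pairing_edge:
  assumes edge: "edge S k t t'" and u: "u \<in> good_elements S Y" and u': "u' \<in> good_elements S Y"
  shows "pairing S \<Lambda> d t u u' = pairing S \<Lambda> d t' u u'"
proof -
  note t = edgeD(2,3)[OF edge]
  obtain g where g: "g_good S Y g u"
    using u unfolding good_elements_def by blast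
  obtain g' where g': "g_good S Y g' u'"
    using u' unfolding good_elements_def by blast
  have pointed: "pointed_at S s u" "pointed_at S s u'" "deg S s u' = g' s" if "s \<in> verts S" for s
    using g g' that unfolding g_good_def g_pointed_def by auto
  have "tropical_point S Y g'" "u \<in> subtraction_free (x t ` {..<m} \<union> zvars n r)"
    using g g' t unfolding g_good_def g_pointed_def by auto
  from edge_val[OF edge this] obtain c
    where "valt t (\<Lambda> t *\<^sub>v g' t) u c" "valt t' (\<Lambda> t' *\<^sub>v g' t') u c"
    by blast
  then have "pairing S \<Lambda> d t u u' = c" "pairing S \<Lambda> d t' u u' = c"
    using pairing_eq_val[OF t(1) pointed(1,2)[OF t(1)]] pairing_eq_val[OF t(2) pointed(1,2)[OF t(2)]]
      pointed(3)[OF t(1)] pointed(3)[OF t(2)] by simp_all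
  then show ?thesis by simp
qed

lemma pairing_independent:
  assumes u: "u \<in> good_elements S Y" and u': "u' \<in> good_elements S Y"
    and t: "t \<in> verts S" "t' \<in> verts S"
  shows "pairing S \<Lambda> d t u u' = pairing S \<Lambda> d t' u u'"
proof -
  have "(\<lambda>v w. \<exists>k. edge S k v w)\<^sup>*\<^sup>* t t'"
    using pattern t unfolding rz_cluster_pattern_def labelled_regular_tree_def by blast
  then show ?thesis
    by induction (use pairing_edge[OF _ u u'] in auto)
qed

end

theorem theorem4p12:
  fixes S :: "'v cluster_pattern"
    and Y \<Lambda> :: "'v \<Rightarrow> int mat"
    and d :: "nat \<Rightarrow> int"
    and \<epsilon> :: int
    and u u' :: ratfun
    and t t' :: 'v
  assumes "\<epsilon> \<in> {1, -1}"
    and "langland_poisson_triple \<epsilon> S Y \<Lambda> d"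
    and "u \<in> good_elements S Y" and "u' \<in> good_elements S Y"
    and "t \<in> verts S" and "t' \<in> verts S"
  shows "pairing S \<Lambda> d t u u' = pairing S \<Lambda> d t' u u'"
proof -
  interpret lp_triple S Y \<Lambda> d \<epsilon>
    using assms(1,2) by unfold_locales
  show ?thesis
    using assms(3-6) by (rule pairing_independent)
qed

end
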